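(* If $n\geq m\geq3$ are odd integers, then there exists a $C_n$-factorization of $C_m[n]$, i.e. $(0,n)\in\mathrm{HWP}(C_m[n];m,n)$.
   Context: $C_m[n]$ is the lexicographic product of the $m$-cycle with the empty graph on $n$ vertices: vertex set $\mathbb{Z}_m\times\mathbb{Z}_n$, with $(x,i)$ adjacent to $(y,j)$ iff $y=x\pm1$ in $\mathbb{Z}_m$ (any $i,j$). A $C_n$-factorization is a partition of the edges into spanning subgraphs all of whose components are $n$-cycles. $\mathrm{HWP}(G;m,n)$ is the set of pairs $(\alpha,\beta)$ such that the edges of $G$ can be partitioned into $\alpha$ $C_m$-factors and $\beta$ $C_n$-factors. *)

theory Defs
  imports Main "HOL-Library.Disjoint_Sets"
begin

text \<open>Simple undirected graphs; an edge is the two-element set of its ends.\<close>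

record 'a ugraph =
  verts :: "'a set"
  edges :: "'a set set"

text \<open>The vertex set represents the residues modulo \<open>n\<close>. This is the \<open>n\<close>-cycle only for
  \<open>n \<ge> 3\<close>: the definition gives a single edge for \<open>n = 2\<close> and a singleton edge for \<open>n = 1\<close>.\<close>

definition cycle_graph :: "nat \<Rightarrow> nat ugraph" where
  "cycle_graph n = \<lparr>verts = {0..<n}, edges = {{i, (i + 1) mod n} | i. i < n}\<rparr>"

definition empty_graph :: "nat \<Rightarrow> nat ugraph" where
  "empty_graph n = \<lparr>verts = {0..<n}, edges = {}\<rparr>"

definition lex_product :: "'a ugraph \<Rightarrow> 'b ugraph \<Rightarrow> ('a \<times> 'b) ugraph" where
  "lex_product G H =
    \<lparr>verts = verts G \<times> verts H,
     edges = {{(x, i), (y, j)} | x i y j.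
       x \<in> verts G \<and> y \<in> verts G \<and> i \<in> verts H \<and> j \<in> verts H \<and>
       ({x, y} \<in> edges G \<or> x = y \<and> {i, j} \<in> edges H)}\<rparr>"

text \<open>The graph $C_m[n]$.\<close>

definition cycle_blowup :: "nat \<Rightarrow> nat \<Rightarrow> (nat \<times> nat) ugraph" where
  "cycle_blowup m n = lex_product (cycle_graph m) (empty_graph n)"

lemma verts_cycle_blowup: "verts (cycle_blowup m n) = {0..<m} \<times> {0..<n}"
  by (simp add: cycle_blowup_def lex_product_def cycle_graph_def empty_graph_def)

lemma adjacent_cycle_blowup_iff:
  "{(x, i), (y, j)} \<in> edges (cycle_blowup m n) \<longleftrightarrow>
     x < m \<and> y < m \<and> i < n \<and> j < n \<and> (y = (x + 1) mod m \<or> x = (y + 1) mod m)"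
proof -
  have cyc: "{x, y} \<in> edges (cycle_graph m) \<longleftrightarrow>
      x < m \<and> y < m \<and> (y = (x + 1) mod m \<or> x = (y + 1) mod m)" for x y
    by (auto simp: cycle_graph_def doubleton_eq_iff)
  have "{(x, i), (y, j)} \<in> edges (cycle_blowup m n) \<longleftrightarrow>
      x < m \<and> y < m \<and> i < n \<and> j < n \<and> {x, y} \<in> edges (cycle_graph m)"
  proof
    assume "{(x, i), (y, j)} \<in> edges (cycle_blowup m n)"
    then show "x < m \<and> y < m \<and> i < n \<and> j < n \<and> {x, y} \<in> edges (cycle_graph m)"
      unfolding cycle_blowup_def lex_product_def cyc
      by (auto simp: cyc[unfolded One_nat_def] cyc empty_graph_def doubleton_eq_iff)
  next
    assume "x < m \<and> y < m \<and> i < n \<and> j < n \<and> {x, y} \<in> edges (cycle_graph m)"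
    then have "x \<in> verts (cycle_graph m) \<and> y \<in> verts (cycle_graph m) \<and>
        i \<in> verts (empty_graph n) \<and> j \<in> verts (empty_graph n) \<and>
        {x, y} \<in> edges (cycle_graph m)"
      by (simp add: cycle_graph_def empty_graph_def)
    then show "{(x, i), (y, j)} \<in> edges (cycle_blowup m n)"
      unfolding cycle_blowup_def lex_product_def by fastforce
  qed
  then show ?thesis
    by (auto simp: cyc)
qed

definition graph_isomorphic :: "'a ugraph \<Rightarrow> 'b ugraph \<Rightarrow> bool" where
  "graph_isomorphic G H \<longleftrightarrow>
    (\<exists>f. bij_betw f (verts G) (verts H) \<and> edges H = (\<lambda>e. f ` e) ` edges G)"

definition induced_subgraph :: "'a ugraph \<Rightarrow> 'a set \<Rightarrow> 'a ugraph" where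
  "induced_subgraph G S = \<lparr>verts = S, edges = {e \<in> edges G. e \<subseteq> S}\<rparr>"

definition components :: "'a ugraph \<Rightarrow> 'a ugraph set" where
  "components G =
    {induced_subgraph G {v \<in> verts G. (\<lambda>x y. {x, y} \<in> edges G)\<^sup>*\<^sup>* u v} | u. u \<in> verts G}"

definition spanning_subgraph :: "'a ugraph \<Rightarrow> 'a ugraph \<Rightarrow> bool" where
  "spanning_subgraph F G \<longleftrightarrow> verts F = verts G \<and> edges F \<subseteq> edges G"

definition cycle_factor :: "nat \<Rightarrow> 'a ugraph \<Rightarrow> 'a ugraph \<Rightarrow> bool" where
  "cycle_factor n G F \<longleftrightarrow>
    spanning_subgraph F G \<and> (\<forall>K \<in> components F. graph_isomorphic K (cycle_graph n))"

text \<open>A spanning subgraph is determined by its edge set, so a factorization is given as a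
  partition of \<open>edges G\<close>, each block \<open>E\<close> standing for the spanning subgraph with edge set \<open>E\<close>.\<close>

definition cycle_factorization :: "nat \<Rightarrow> 'a ugraph \<Rightarrow> 'a set set set \<Rightarrow> bool" where
  "cycle_factorization n G P \<longleftrightarrow>
    partition_on (edges G) P \<and> (\<forall>E \<in> P. cycle_factor n G \<lparr>verts = verts G, edges = E\<rparr>)"

text \<open>Disjointness of \<open>A\<close> and \<open>B\<close> only matters for \<open>m = n\<close>, where it prevents a factor from
  being counted twice.\<close>

definition HWP :: "'a ugraph \<Rightarrow> nat \<Rightarrow> nat \<Rightarrow> (nat \<times> nat) set" where
  "HWP G m n = {(\<alpha>, \<beta>). \<exists>A B.
     finite A \<and> card A = \<alpha> \<and> finite B \<and> card B = \<beta> \<and> A \<inter> B = {} \<and>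
     partition_on (edges G) (A \<union> B) \<and>
     (\<forall>E \<in> A. cycle_factor m G \<lparr>verts = verts G, edges = E\<rparr>) \<and>
     (\<forall>E \<in> B. cycle_factor n G \<lparr>verts = verts G, edges = E\<rparr>)}"

end

theory Submission
  imports Defs
begin

text \<open>Write \<open>n = m + 2 * b\<close>. All \<open>n\<close> factors are copies of one abstract 2-factor, whose vertices are
  slots \<open>s < n\<close> in the columns \<open>x < m\<close>: the factor number \<open>c\<close> puts slot \<open>s\<close> of column \<open>x\<close> into
  row \<open>L x c s\<close>. If the slots of neighbouring columns move in opposite directions, as \<open>s + c\<close>
  and \<open>s - c\<close>, then every edge between these columns is used exactly once as soon as the sums of
  adjacent slots are distinct modulo \<open>n\<close>. Since \<open>n\<close> is odd, this holds for the cyclic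
  sequence \<open>0, 1, \<dots>, n - 1\<close>: the cycle number \<open>j\<close> first alternates between the columns \<open>j\<close> and
  \<open>j + 1\<close> and then runs once around.

  As \<open>m\<close> is odd, the directions cannot alternate all the way around. So the slots of column 0 stand
  still, which works if each of them has one neighbour on either side. For even \<open>b\<close> this is
  achieved by rewiring the two cycles that alternate between column 0 and a neighbouring column. For
  odd \<open>b\<close> two slots of column 0 with both neighbours on the same side are left; together with two
  other slots they exchange their rows, guided by a colouring of the factors with 4 colours in
  which \<open>c\<close>, \<open>c + 2\<close> and \<open>c + 4\<close> always differ. For \<open>b = 1\<close> the slots to be exchanged do not exist;
  there column 2 is treated like column 0, which makes the labelling of column 1 arbitrary, and a
  suitable labelling creates them.\<close>

section \<open>Factorizations from arrays\<close>

lemma rtranclp_cyclic: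
  fixes n k l :: nat
  assumes "\<And>k. k < n \<Longrightarrow> R (f k) (f ((k + 1) mod n))" "k < n" "l < n"
  shows "R\<^sup>*\<^sup>* (f k) (f l)"
proof -
  have "R\<^sup>*\<^sup>* (f k) (f ((k + d) mod n))" for d
  proof (induction d)
    case 0
    then show ?case using assms by simp
  next
    case (Suc d)
    have "R (f ((k + d) mod n)) (f (((k + d) mod n + 1) mod n))"
      using assms by (intro assms(1)) auto
    then show ?case using Suc by (simp add: mod_Suc_eq rtranclp.rtrancl_into_rtrancl)
  qed
  from this[of "n - k + l"] show ?thesis using assms(2,3) by simp
qed

text \<open>Since \<open>V\<close> hits every vertex exactly once, the closed walks
  \<open>V j\<close> are disjoint. So no edge leaves its walk, the components are precisely these
  walks, and inverting \<open>V j\<close> identifies each of them with the standard cycle.\<close>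

lemma cycle_factorI:
  fixes V :: "nat \<Rightarrow> nat \<Rightarrow> 'a"
  assumes bij: "bij_betw (case_prod V) ({..<m} \<times> {..<n}) (verts G)"
    and sub: "(\<lambda>(j, k). {V j k, V j ((k + 1) mod n)}) ` ({..<m} \<times> {..<n}) \<subseteq> edges G"
  shows "cycle_factor n G
    \<lparr>verts = verts G, edges = (\<lambda>(j, k). {V j k, V j ((k + 1) mod n)}) ` ({..<m} \<times> {..<n})\<rparr>"
    (is "cycle_factor n G ?F")
proof -
  have inj: "V j k = V j' k' \<longleftrightarrow> j = j' \<and> k = k'"
    if "j < m" "k < n" "j' < m" "k' < n" for j k j' k'
    using bij that unfolding bij_betw_def inj_on_def by auto
  have adj: "\<exists>k' < n. v = V j k'"
    if "j < m" "k < n" and e: "{V j k, v} \<in> edges ?F" for j k v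
  proof -
    from e obtain j' k' where j': "j' < m" "k' < n" "{V j k, v} = {V j' k', V j' ((k' + 1) mod n)}"
      by auto
    then have "(k' + 1) mod n < n" by simp
    with j' that inj show ?thesis
      unfolding doubleton_eq_iff by metis
  qed
  have "graph_isomorphic K (cycle_graph n)" if K: "K \<in> components ?F" for K
  proof -
    let ?R = "\<lambda>x y. {x, y} \<in> edges ?F"
    obtain u where u: "u \<in> verts G"
      and Ku: "K = induced_subgraph ?F {v \<in> verts ?F. ?R\<^sup>*\<^sup>* u v}"
      using K by (auto simp: components_def)
    obtain j k where jk: "j < m" "k < n" "u = V j k"
      using u unfolding bij_betw_imp_surj_on[OF bij, symmetric] by auto
    have "\<exists>k' < n. v = V j k'" if "?R\<^sup>*\<^sup>* u v" for v
      using that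
    proof induction
      case base
      then show ?case using jk by auto
    next
      case (step y z)
      then show ?case using adj[of j] jk by blast
    qed
    moreover have "?R\<^sup>*\<^sup>* u (V j k')" if "k' < n" for k'
      unfolding jk(3) by (rule rtranclp_cyclic[of n]) (use jk that in auto)
    moreover have "V j k' \<in> verts G" if "k' < n" for k'
      using bij that jk by (auto simp: bij_betw_def)
    ultimately have S: "{v \<in> verts ?F. ?R\<^sup>*\<^sup>* u v} = V j ` {..<n}"
      by auto
    have E: "{e \<in> edges ?F. e \<subseteq> V j ` {..<n}} = (\<lambda>k. {V j k, V j ((k + 1) mod n)}) ` {..<n}"
    proof -
      have "e \<in> (\<lambda>k. {V j k, V j ((k + 1) mod n)}) ` {..<n}"
        if e: "e \<in> edges ?F" "e \<subseteq> V j ` {..<n}" for e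
      proof -
        from e(1) obtain j' k' where j': "j' < m" "k' < n" "e = {V j' k', V j' ((k' + 1) mod n)}"
          by auto
        with e(2) obtain i where "i < n" "V j' k' = V j i" by auto
        with j' jk inj have "j' = j" by blast
        with j' show ?thesis by auto
      qed
      moreover have "{V j k, V j ((k + 1) mod n)} \<subseteq> V j ` {..<n}" if "k < n" for k
        using that by auto
      ultimately show ?thesis using jk(1) by fastforce
    qed
    have b: "bij_betw (V j) {0..<n} (V j ` {..<n})"
      using jk inj by (auto simp: bij_betw_def inj_on_def)
    let ?g = "inv_into {0..<n} (V j)"
    have g: "?g (V j k) = k" if "k < n" for k
      using that b by (auto simp: bij_betw_def)
    have "edges (cycle_graph n) = (\<lambda>k. {k, (k + 1) mod n}) ` {..<n}"
      by (auto simp: cycle_graph_def)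
    also have "\<dots> = (\<lambda>e. ?g ` e) ` (\<lambda>k. {V j k, V j ((k + 1) mod n)}) ` {..<n}"
      unfolding image_image using jk by (intro image_cong) (auto simp: g)
    finally have "edges (cycle_graph n) = (\<lambda>e. ?g ` e) ` edges K"
      by (simp add: Ku induced_subgraph_def S[simplified] E[simplified])
    moreover have "bij_betw ?g (verts K) (verts (cycle_graph n))"
      using bij_betw_inv_into[OF b] by (simp add: Ku induced_subgraph_def S[simplified] cycle_graph_def)
    ultimately show ?thesis
      unfolding graph_isomorphic_def by blast
  qed
  then show ?thesis
    using sub by (auto simp: cycle_factor_def spanning_subgraph_def)
qed

text \<open>Every edge is directed from a column \<open>x\<close> to \<open>x + 1\<close> in exactly
  one way, and these directed edges can be counted. With only two columns both directions would
  qualify.\<close>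

lemma card_edges_cycle_blowup:
  assumes "m \<ge> 3"
  shows "card (edges (cycle_blowup m n)) = m * n * n" "finite (edges (cycle_blowup m n))"
proof -
  let ?f = "\<lambda>(x, i, i'). {(x, i), ((x + 1) mod m, i')}"
  let ?T = "{..<m} \<times> {..<n} \<times> {..<n}"
  have "edges (cycle_blowup m n) = ?f ` ?T"
  proof (intro equalityI subsetI)
    fix e assume e: "e \<in> edges (cycle_blowup m n)"
    then obtain x i y j where [simp]: "e = {(x, i), (y, j)}"
      unfolding cycle_blowup_def lex_product_def by auto
    from e have "(x, i, j) \<in> ?T \<and> e = ?f (x, i, j) \<or> (y, j, i) \<in> ?T \<and> e = ?f (y, j, i)"
      using adjacent_cycle_blowup_iff[of x i y j m n] by (auto simp: insert_commute)
    then show "e \<in> ?f ` ?T" by blast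
  next
    fix e assume "e \<in> ?f ` ?T"
    then show "e \<in> edges (cycle_blowup m n)"
      using assms by (auto simp: adjacent_cycle_blowup_iff)
  qed
  moreover have "inj_on ?f ?T"
  proof -
    have "(x + 1) mod m \<noteq> x" "((x + 1) mod m + 1) mod m \<noteq> x" if "x < m" for x
      using that assms by (auto simp: mod_Suc)
    then show ?thesis
      by (fastforce simp: inj_on_def doubleton_eq_iff)
  qed
  ultimately show "card (edges (cycle_blowup m n)) = m * n * n" "finite (edges (cycle_blowup m n))"
    by (simp_all add: card_image)
qed

text \<open>The abstract edges between columns \<open>x\<close> and \<open>x + 1\<close> of the 2-factor whose \<open>k\<close>-th vertex on the
  \<open>j\<close>-th cycle is \<open>pos j k\<close>.\<close>

definition gap_edge :: "(nat \<Rightarrow> nat \<Rightarrow> nat \<times> nat) \<Rightarrow> nat \<Rightarrow> nat \<Rightarrow> nat \<Rightarrow> nat \<Rightarrow> nat \<Rightarrow> bool" where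
  "gap_edge pos m n x s t \<longleftrightarrow> (\<exists>j < m. \<exists>k < n.
     pos j k = (x, s) \<and> pos j ((k + 1) mod n) = ((x + 1) mod m, t) \<or>
     pos j k = ((x + 1) mod m, t) \<and> pos j ((k + 1) mod n) = (x, s))"

text \<open>\<open>pos j k\<close> is the column and slot of a vertex of the abstract 2-factor,
  \<open>L x c s\<close> the row of slot \<open>s\<close> in factor \<open>c\<close>. Only covering
  is demanded: the \<open>n\<close> copies have \<open>n * m * n\<close> edges counted with
  repetition, as many as the graph, so covering forces disjointness.\<close>

lemma factorization_from_arrays:
  fixes pos :: "nat \<Rightarrow> nat \<Rightarrow> nat \<times> nat" and L :: "nat \<Rightarrow> nat \<Rightarrow> nat \<Rightarrow> nat"
  assumes m: "m \<ge> 3" and n: "n \<ge> 3"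
    and pos: "case_prod pos ` ({..<m} \<times> {..<n}) = {..<m} \<times> {..<n}"
    and adj: "\<And>j k. j < m \<Longrightarrow> k < n \<Longrightarrow>
      fst (pos j ((k + 1) mod n)) = (fst (pos j k) + 1) mod m \<or>
      fst (pos j k) = (fst (pos j ((k + 1) mod n)) + 1) mod m"
    and L: "\<And>x c. x < m \<Longrightarrow> c < n \<Longrightarrow> L x c ` {..<n} = {..<n}"
    and cover: "\<And>x i i'. x < m \<Longrightarrow> i < n \<Longrightarrow> i' < n \<Longrightarrow>
      \<exists>c < n. \<exists>s t. gap_edge pos m n x s t \<and> L x c s = i \<and> L ((x + 1) mod m) c t = i'"
  shows "(\<exists>P. cycle_factorization n (cycle_blowup m n) P) \<and> (0, n) \<in> HWP (cycle_blowup m n) m n"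
proof -
  let ?G = "cycle_blowup m n"
  define V where "V c j k = (fst (pos j k), L (fst (pos j k)) c (snd (pos j k)))" for c j k
  define e where "e = (\<lambda>(c, j, k). {V c j k, V c j ((k + 1) mod n)})"
  define E where "E c = (\<lambda>(j, k). {V c j k, V c j ((k + 1) mod n)}) ` ({..<m} \<times> {..<n})" for c
  let ?T = "{..<n} \<times> {..<m} \<times> {..<n}"
  have bij: "bij_betw (case_prod (V c)) ({..<m} \<times> {..<n}) (verts ?G)" if c: "c < n" for c
  proof -
    let ?h = "\<lambda>(x, s). (x, L x c s)"
    have "?h ` ({..<m} \<times> {..<n}) = (SIGMA x:{..<m}. L x c ` {..<n})"
      by force
    also have "\<dots> = {..<m} \<times> {..<n}"
      using L c by auto
    finally have "?h ` (case_prod pos ` ({..<m} \<times> {..<n})) = {..<m} \<times> {..<n}"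
      using pos by simp
    moreover have "?h ` (case_prod pos ` ({..<m} \<times> {..<n})) = case_prod (V c) ` ({..<m} \<times> {..<n})"
      by (auto simp: image_image V_def case_prod_beta)
    ultimately have im: "case_prod (V c) ` ({..<m} \<times> {..<n}) = {..<m} \<times> {..<n}"
      by simp
    then have "inj_on (case_prod (V c)) ({..<m} \<times> {..<n})"
      by (intro eq_card_imp_inj_on) auto
    with im show ?thesis
      by (simp add: bij_betw_def verts_cycle_blowup atLeast0LessThan)
  qed
  have Vin: "V c j k \<in> {..<m} \<times> {..<n}" if "c < n" "j < m" "k < n" for c j k
  proof -
    have "case_prod (V c) (j, k) \<in> verts ?G"
      using bij[OF that(1)] that(2,3) unfolding bij_betw_def by blast
    then show ?thesis by (auto simp: verts_cycle_blowup)
  qed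
  have esub: "e (c, j, k) \<in> edges ?G" if "c < n" "j < m" "k < n" for c j k
  proof -
    have "(k + 1) mod n < n" using n by simp
    with Vin that have "V c j k \<in> {..<m} \<times> {..<n}" "V c j ((k + 1) mod n) \<in> {..<m} \<times> {..<n}"
      by blast+
    then show ?thesis
      using adj[OF that(2,3)] unfolding e_def V_def by (auto simp: adjacent_cycle_blowup_iff)
  qed
  have "edges ?G \<subseteq> e ` ?T"
  proof
    fix f assume f: "f \<in> edges ?G"
    then obtain x i y j where "f = {(x, i), (y, j)}"
      unfolding cycle_blowup_def lex_product_def by auto
    with f obtain x i i' where x: "x < m" "i < n" "i' < n" "f = {(x, i), ((x + 1) mod m, i')}"
      using adjacent_cycle_blowup_iff[of x i y j m n] by (metis insert_commute)
    from cover[OF x(1-3)] obtain c s t where c: "c < n" "gap_edge pos m n x s t"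
      "L x c s = i" "L ((x + 1) mod m) c t = i'"
      by blast
    from c(2) obtain j k where "j < m" "k < n"
      "pos j k = (x, s) \<and> pos j ((k + 1) mod n) = ((x + 1) mod m, t) \<or>
       pos j k = ((x + 1) mod m, t) \<and> pos j ((k + 1) mod n) = (x, s)"
      unfolding gap_edge_def by blast
    with c have "(c, j, k) \<in> ?T" "f = e (c, j, k)"
      unfolding x(4) e_def V_def by (auto simp: insert_commute)
    then show "f \<in> e ` ?T" by blast
  qed
  with esub have im: "e ` ?T = edges ?G" by auto
  \<comment> \<open>Being onto a set of the same finite size, \<open>e\<close> is injective: no edge
    is used twice.\<close>
  have "card (e ` ?T) = card ?T"
    unfolding im using card_edges_cycle_blowup[OF m, of n] by (simp add: card_cartesian_product)
  then have inj: "inj_on e ?T"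
    by (intro eq_card_imp_inj_on) auto
  have Ee: "E c = (\<lambda>(j, k). e (c, j, k)) ` ({..<m} \<times> {..<n})" for c
    by (simp add: E_def e_def)
  have part: "partition_on (edges ?G) (E ` {..<n})"
  proof (rule partition_onI)
    have "\<Union> (E ` {..<n}) = e ` ?T"
      unfolding Ee by force
    then show "\<Union> (E ` {..<n}) = edges ?G" using im by simp
  next
    fix p q assume "p \<in> E ` {..<n}" "q \<in> E ` {..<n}" "p \<noteq> q"
    then obtain c d where "c < n" "d < n" "p = E c" "q = E d" "c \<noteq> d" by blast
    then show "disjnt p q"
      using inj unfolding disjnt_def Ee inj_on_def by fastforce
  next
    show "{} \<notin> E ` {..<n}"
      using m n by (auto simp: E_def lessThan_empty_iff)
  qed
  \<comment> \<open>The blocks form a set, so distinct factors must have distinct edge sets for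
    their number to be \<open>n\<close>.\<close>
  have "inj_on E {..<n}"
  proof (rule inj_onI)
    fix c d assume cd: "c \<in> {..<n}" "d \<in> {..<n}" "E c = E d"
    have "e (c, 0, 0) \<in> E c" using m n by (force simp: Ee)
    then have "e (c, 0, 0) \<in> E d" using cd by simp
    then obtain j k where "j < m" "k < n" "e (c, 0, 0) = e (d, j, k)"
      unfolding Ee by force
    then show "c = d"
      using inj cd m n unfolding inj_on_def by (metis (no_types, lifting) Pair_inject SigmaI lessThan_iff
          less_le_trans zero_less_numeral)
  qed
  then have card: "card (E ` {..<n}) = n" by (simp add: card_image)
  have fac: "cycle_factor n ?G \<lparr>verts = verts ?G, edges = p\<rparr>" if "p \<in> E ` {..<n}" for p
  proof -
    from that obtain c where c: "c < n" "p = E c" by blast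
    have "E c \<subseteq> edges ?G"
      unfolding Ee using esub c by auto
    then show ?thesis
      using cycle_factorI[OF bij[OF c(1)]] unfolding c(2) E_def by blast
  qed
  have "cycle_factorization n ?G (E ` {..<n})"
    unfolding cycle_factorization_def using part fac by blast
  moreover have "(0, n) \<in> HWP ?G m n"
    unfolding HWP_def mem_Collect_eq prod.case
    by (intro exI[of _ "{}"] exI[of _ "E ` {..<n}"]) (use part fac card in simp)
  ultimately show ?thesis by blast
qed

section \<open>The common shape of the factors\<close>

text \<open>The offset of the \<open>k\<close>-th vertex of a cycle from its starting column. It
  reaches \<open>m - 1\<close> at the last vertex, so the step that closes the cycle again goes one
  column up.\<close>

definition climb :: "nat \<Rightarrow> nat \<Rightarrow> nat" where
  "climb b k = (if k \<le> 2 * b then k mod 2 else k - 2 * b)"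

text \<open>The \<open>k\<close>-th vertex on the \<open>j\<close>-th cycle. The first three cases rewire the cycles \<open>0\<close> and
  \<open>m - 1\<close> so that they pass through column 0 instead of turning around there.\<close>

definition layout :: "nat \<Rightarrow> nat \<Rightarrow> nat \<Rightarrow> nat \<Rightarrow> nat \<times> nat" where
  "layout m b j k =
    (if j = 0 \<and> k < 4 * (b div 2) \<and> k mod 4 = 1 then (1, k + 2)
     else if j = 0 \<and> k < 4 * (b div 2) \<and> k mod 4 = 3 then (m - 1, k - 1)
     else if j = m - 1 \<and> k < 4 * (b div 2) \<and> k mod 4 = 2 then (1, k - 1)
     else ((j + climb b k) mod m, k))"

lemma layout_std:
  "k \<ge> 4 * (b div 2) \<or> j \<noteq> 0 \<and> j \<noteq> m - 1 \<or> k mod 4 = 0 \<Longrightarrow>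
    layout m b j k = ((j + climb b k) mod m, k)"
  by (auto simp: layout_def)

lemma gap_edgeI:
  assumes "j < m" "k < n" "pos j k = (x, s)" "pos j ((k + 1) mod n) = ((x + 1) mod m, t)"
  shows "gap_edge pos m n x s t"
  using assms unfolding gap_edge_def by blast

lemma gap_edgeI':
  assumes "j < m" "k < n" "pos j k = ((x + 1) mod m, t)" "pos j ((k + 1) mod n) = (x, s)"
  shows "gap_edge pos m n x s t"
  using assms unfolding gap_edge_def by blast

lemma mod_4_cases:
  fixes k :: nat
  obtains "k mod 4 = 0" | "k mod 4 = 1" | "k mod 4 = 2" | "k mod 4 = 3"
proof -
  have "k mod 4 < 4" by simp
  then have "k mod 4 = 0 \<or> k mod 4 = 1 \<or> k mod 4 = 2 \<or> k mod 4 = 3" by linarith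
  then show thesis using that by metis
qed

lemma Suc_less_mult_4: "k < 4 * d \<Longrightarrow> k mod 4 \<noteq> 3 \<Longrightarrow> k + 1 < 4 * (d::nat)"
  by presburger

lemma mod_2_if_mod_4:
  fixes k :: nat
  shows "k mod 4 = 0 \<Longrightarrow> k mod 2 = 0" "k mod 4 = 1 \<Longrightarrow> k mod 2 = 1"
    "k mod 4 = 2 \<Longrightarrow> k mod 2 = 0" "k mod 4 = 3 \<Longrightarrow> k mod 2 = 1"
  by presburger+

context
  fixes m b n :: nat
  assumes m: "m \<ge> 3" and n: "n = m + 2 * b"
begin

text \<open>For \<open>d < b div 2\<close> the rewiring permutes the positions
  \<open>(1, 4 * d + 1)\<close>, \<open>(1, 4 * d + 3)\<close> and \<open>(m - 1, 4 * d + 2)\<close>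
  among the cycles \<open>0\<close> and \<open>m - 1\<close>; all other positions keep their
  standard preimage.\<close>

lemma layout_image: "case_prod (layout m b) ` ({..<m} \<times> {..<n}) = {..<m} \<times> {..<n}"
proof (intro equalityI subsetI)
  fix p assume "p \<in> case_prod (layout m b) ` ({..<m} \<times> {..<n})"
  then obtain j k where jk: "j < m" "k < n" "p = layout m b j k" by auto
  define K where "K = 4 * (b div 2)"
  have "K \<le> 2 * b" by (simp add: K_def)
  then show "p \<in> {..<m} \<times> {..<n}"
    using m n jk unfolding jk layout_def K_def[symmetric] by auto
next
  fix p assume "p \<in> {..<m} \<times> {..<n}"
  then obtain x s where p: "x < m" "s < n" "p = (x, s)" by auto
  have "\<exists>j < m. \<exists>k < n. layout m b j k = (x, s)"
  proof (cases "s < 4 * (b div 2) \<and> (x = 1 \<and> s mod 2 = 1 \<or> x = m - 1 \<and> s mod 4 = 2)")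
    case True
    then have "x = 1 \<and> s mod 4 = 3 \<or> x = 1 \<and> s mod 4 = 1 \<or> x = m - 1 \<and> s mod 4 = 2"
      using mod_2_if_mod_4[of s] by (cases s rule: mod_4_cases) auto
    then consider "x = 1" "s mod 4 = 3" | "x = 1" "s mod 4 = 1" | "x = m - 1" "s mod 4 = 2"
      by metis
    then show ?thesis
    proof cases
      case 1
      have "s mod 4 \<le> s" by simp
      then obtain t where s: "s = t + 3" using 1(2) by (metis add.commute le_Suc_ex)
      have "(t + 3) mod 4 = 3" using 1(2) s by simp
      then have "(t + 1) mod 4 = 1" by presburger
      moreover have "t + 1 < 4 * (b div 2)" using True s by simp
      ultimately have "layout m b 0 (t + 1) = (x, s)"
        using 1(1) s by (simp add: layout_def)
      moreover have "0 < m" "t + 1 < n" using p(2) m s by simp_all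
      ultimately show ?thesis by blast
    next
      case 2
      have lt: "s + 1 < 4 * (b div 2)" using True 2 Suc_less_mult_4[of s "b div 2"] by simp
      have "(s + 1) mod 4 = 2" using 2 by (simp add: mod_Suc)
      then have "layout m b (m - 1) (s + 1) = (x, s)" using 2(1) m lt by (simp add: layout_def)
      moreover have "m - 1 < m" "s + 1 < n" using m n lt by linarith+
      ultimately show ?thesis by blast
    next
      case 3
      have lt: "s + 1 < 4 * (b div 2)" using True 3 Suc_less_mult_4[of s "b div 2"] by simp
      have "(s + 1) mod 4 = 3" using 3 by (simp add: mod_Suc)
      then have "layout m b 0 (s + 1) = (x, s)" using 3(1) m lt by (simp add: layout_def)
      moreover have "0 < m" "s + 1 < n" using m n lt by linarith+
      ultimately show ?thesis by blast
    qed
  next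
    case False
    \<comment> \<open>Adding \<open>m\<close> prevents truncation of the subtraction, as the offset
      is below \<open>m\<close>.\<close>
    define j where "j = (x + m - climb b s) mod m"
    have w: "climb b s < m" using p m n by (auto simp: climb_def)
    have jw: "(j + climb b s) mod m = x"
    proof -
      have "(j + climb b s) mod m = (x + m - climb b s + climb b s) mod m"
        unfolding j_def by (simp add: mod_add_left_eq)
      also have "x + m - climb b s + climb b s = x + m" using w by simp
      finally show ?thesis using p by simp
    qed
    have "j < m" unfolding j_def using m by simp
    have "layout m b j s = (x, s)"
    proof (cases "s < 4 * (b div 2)")
      case small: True
      then have cl: "climb b s = s mod 2" by (auto simp: climb_def)
      have "\<not> (j = 0 \<and> s mod 4 = 1)" "\<not> (j = 0 \<and> s mod 4 = 3)" "\<not> (j = m - 1 \<and> s mod 4 = 2)"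
        using False small jw m cl mod_2_if_mod_4[of s] by auto
      then show ?thesis using jw by (auto simp: layout_def)
    next
      case False
      then show ?thesis using jw by (simp add: layout_std)
    qed
    then show ?thesis using \<open>j < m\<close> p by blast
  qed
  then obtain j k where "j < m" "k < n" "layout m b j k = p" using p by blast
  then show "p \<in> case_prod (layout m b) ` ({..<m} \<times> {..<n})" by force
qed

lemma climb_step:
  assumes "k + 1 < n"
  shows "climb b (k + 1) = climb b k + 1 \<or> climb b k = climb b (k + 1) + 1"
proof (cases "k mod 2 = 0")
  case True
  then have "(k + 1) mod 2 = 1" by presburger
  then show ?thesis using True by (auto simp: climb_def)
next
  case False
  then have "(k + 1) mod 2 = 0" "k mod 2 = 1" "k \<noteq> 2 * b" by presburger+
  then show ?thesis by (auto simp: climb_def)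
qed

lemma layout_adjacent:
  assumes j: "j < m" and k: "k < n"
  shows "fst (layout m b j ((k + 1) mod n)) = (fst (layout m b j k) + 1) mod m \<or>
    fst (layout m b j k) = (fst (layout m b j ((k + 1) mod n)) + 1) mod m"
proof (cases "k < 4 * (b div 2) \<and> (j = 0 \<or> j = m - 1)")
  case True
  define K where "K = 4 * (b div 2)"
  have K: "K \<le> 2 * b" by (simp add: K_def)
  have kK: "k < K" and j': "j = 0 \<or> j = m - 1" using True by (auto simp: K_def)
  then have n1: "(k + 1) mod n = k + 1" using m n K by simp
  have m1: "(1::nat) mod m = 1" "(m - 1) mod m = m - 1" "Suc (m - 1) mod m = 0" "m - 1 \<noteq> 0" "m - 1 \<noteq> 1"
    using m by auto
  have cl: "climb b k = k mod 2" "climb b (k + 1) = (k + 1) mod 2"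
    using kK K by (auto simp: climb_def)
  \<comment> \<open>\<open>K\<close> is a multiple of 4, so only the last index of a block can have
    its successor outside the rewired range.\<close>
  have step: "k mod 4 = 3 \<or> k + 1 < K"
    using kK Suc_less_mult_4[of k "b div 2"] unfolding K_def by blast
  have m2: "(k + 1) mod 2 = 1 - k mod 2" by (simp add: mod_Suc)
  have m4: "(k + 1) mod 4 = (if k mod 4 = 3 then 0 else k mod 4 + 1)" by (simp add: mod_Suc)
  show ?thesis
    using j'
  proof
    assume "j = 0"
    then show ?thesis
      using kK step m1 cl m2 m4 mod_2_if_mod_4[of k] unfolding n1 layout_def K_def[symmetric]
      by (cases k rule: mod_4_cases) simp_all
  next
    assume "j = m - 1"
    then show ?thesis
      using kK step m1 cl m2 m4 mod_2_if_mod_4[of k] unfolding n1 layout_def K_def[symmetric]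
      by (cases k rule: mod_4_cases) simp_all
  qed
next
  case False
  then have k0: "layout m b j k = ((j + climb b k) mod m, k)" by (auto simp: layout_std)
  show ?thesis
  proof (cases "k + 1 < n")
    case True
    have "layout m b j (k + 1) = ((j + climb b (k + 1)) mod m, k + 1)"
      using False by (intro layout_std) auto
    then show ?thesis
      using k0 True climb_step[OF True] by (auto simp: mod_simps)
  next
    case top: False
    then have "k + 1 = n" using k by simp
    then have "climb b k = m - 1" "(k + 1) mod n = 0" using m n by (auto simp: climb_def)
    moreover have "layout m b j 0 = (j mod m, 0)"
      by (simp add: layout_std climb_def)
    ultimately show ?thesis
      using k0 j m by (auto simp: mod_simps)
  qed
qed

text \<open>Past index \<open>2 * b\<close> every step goes one column up, so for a given
  \<open>k\<close> the cycle that is in column \<open>x\<close> can be found by subtracting the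
  offset.\<close>

lemma gap_edge_straight:
  assumes x: "x < m" and k: "2 * b < k" "k < n"
  shows "gap_edge (layout m b) m n x k ((k + 1) mod n)"
proof -
  define j where "j = (x + m - (k - 2 * b)) mod m"
  have j: "j < m" using m by (simp add: j_def)
  have "(j + (k - 2 * b)) mod m = (x + m - (k - 2 * b) + (k - 2 * b)) mod m"
    unfolding j_def by (simp add: mod_add_left_eq)
  also have "x + m - (k - 2 * b) + (k - 2 * b) = x + m" using k n by simp
  finally have jx: "(j + (k - 2 * b)) mod m = x" using x by simp
  have K: "4 * (b div 2) \<le> 2 * b" by simp
  have l: "layout m b j k = (x, k)"
    using k K jx by (subst layout_std) (auto simp: climb_def)
  have "layout m b j ((k + 1) mod n) = ((x + 1) mod m, (k + 1) mod n)"
  proof (cases "k + 1 = n")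
    case True
    then have "k - 2 * b = m - 1" using n m by simp
    then have "(j + (m - 1) + 1) mod m = (x + 1) mod m"
      using jx by (metis mod_add_left_eq)
    then have "j = (x + 1) mod m" using j m by simp
    with True j show ?thesis by (simp add: layout_std climb_def)
  next
    case False
    have "(j + (k - 2 * b) + 1) mod m = (x + 1) mod m"
      using jx by (metis mod_add_left_eq)
    with False k K show ?thesis by (subst layout_std) (auto simp: climb_def Suc_diff_le)
  qed
  with j k l show ?thesis by (intro gap_edgeI) auto
qed

text \<open>Cycle \<open>x\<close> itself alternates between the columns \<open>x\<close> and
  \<open>x + 1\<close>, with its even slots in column \<open>x\<close>. The second assumption keeps
  away from the rewired cycles.\<close>

lemma gap_edge_zigzag:
  assumes x: "x < m" and "b div 2 = 0 \<or> x \<noteq> 0 \<and> x \<noteq> m - 1" and k: "k \<le> 2 * b"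
  shows "gap_edge (layout m b) m n x (if even k then k else k + 1) (if even k then k + 1 else k)"
proof -
  have k1: "(k + 1) mod n = k + 1" "k < n" using k n m by auto
  have l: "layout m b x i = ((x + climb b i) mod m, i)" for i
    using assms(2) by (intro layout_std) auto
  show ?thesis
  proof (cases "even k")
    case True
    then have "climb b k = 0" "climb b (k + 1) = 1" using k by (auto simp: climb_def)
    then show ?thesis using True x k1 l[of k] l[of "k + 1"] by (intro gap_edgeI[of x _ k]) auto
  next
    case False
    then have "climb b k = 1" "climb b (k + 1) = 0" using k
      by (auto simp: climb_def odd_iff_mod_2_eq_one) presburger
    then show ?thesis using False x k1 l[of k] l[of "k + 1"] by (intro gap_edgeI'[of x _ k]) auto
  qed
qed

text \<open>Away from column 0 both parts of the cycles join consecutive slots. The orientation is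
  left open because only the sum \<open>2 * k + 1\<close> of the two slots is used later.\<close>

lemma gap_edge_consecutive:
  assumes x: "0 < x" "x < m - 1" and k: "k < n"
  shows "gap_edge (layout m b) m n x k ((k + 1) mod n) \<or>
    gap_edge (layout m b) m n x ((k + 1) mod n) k"
proof (cases "k \<le> 2 * b")
  case True
  then have "(k + 1) mod n = k + 1" using n m by simp
  with gap_edge_zigzag[of x k] True x show ?thesis by (cases "even k") auto
next
  case False
  with gap_edge_straight[of x k] x k show ?thesis by auto
qed

end

section \<open>Columns with exchanged rows\<close>

definition row :: "nat \<Rightarrow> int \<Rightarrow> nat" where
  "row n z = nat (z mod int n)"

lemma row_less [simp]: "n > 0 \<Longrightarrow> row n z < n"
  by (simp add: row_def nat_less_iff)

lemma int_row [simp]: "n > 0 \<Longrightarrow> int (row n z) = z mod int n"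
  by (simp add: row_def)

lemma row_of_nat: "i < n \<Longrightarrow> row n (int i) = i"
  by (simp add: row_def)

lemma row_eqI: "i < n \<Longrightarrow> (z - int i) mod int n = 0 \<Longrightarrow> row n z = i"
  by (metis mod_eq_dvd_iff mod_0_imp_dvd nat_int row_def row_of_nat)

lemma row_image:
  assumes n: "n > 0" and lab: "lab ` {..<n} = {..<n}"
  shows "(\<lambda>s. row n (int (lab s) + d)) ` {..<n} = {..<n}"
proof (intro equalityI subsetI)
  fix v assume v: "v \<in> {..<n}"
  then have "row n (int v - d) \<in> lab ` {..<n}"
    using n lab by simp
  then obtain s where s: "s < n" "row n (int v - d) = lab s" by auto
  then have "int (lab s) = (int v - d) mod int n" using n by (metis int_row)
  then have "row n (int (lab s) + d) = row n (int v - d + d)"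
    unfolding row_def by (simp only: mod_add_left_eq)
  then have "row n (int (lab s) + d) = v"
    using v by (simp add: row_of_nat)
  with s show "v \<in> (\<lambda>s. row n (int (lab s) + d)) ` {..<n}" by auto
qed (use n in auto)

lemma halve:
  assumes "odd n"
  obtains u where "u < n" "(2 * int u - z) mod int n = 0"
proof -
  obtain h where n: "n = 2 * h + 1" using assms by (elim oddE)
  then have n0: "n > 0" by simp
  \<comment> \<open>\<open>h + 1\<close> is the inverse of 2 modulo
    \<open>2 * h + 1\<close>.\<close>
  define u where "u = row n (z * (int h + 1))"
  have "(2 * int u - z) mod int n = (2 * (z * (int h + 1)) - z) mod int n"
    unfolding u_def int_row[OF n0] by (intro mod_diff_cong mod_mult_right_eq refl)
  also have "2 * (z * (int h + 1)) - z = z * int n" unfolding n by (simp add: algebra_simps)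
  finally have "(2 * int u - z) mod int n = 0" by simp
  moreover have "u < n" using n0 unfolding u_def by (rule row_less)
  ultimately show thesis by (intro that)
qed

text \<open>A colouring of the factors, periodic on the integers so that shifted arguments need no
  reduction. In factor \<open>c\<close> the first three exchanged slots use the colours at
  \<open>c\<close>, \<open>c + 2\<close> and \<open>c + 4\<close>, which therefore have to
  differ.\<close>

definition rainbow :: "nat \<Rightarrow> (int \<Rightarrow> nat) \<Rightarrow> bool" where
  "rainbow n q \<longleftrightarrow> (\<forall>c. q (c mod int n) = q c \<and> q c < 4 \<and> distinct [q c, q (c + 2), q (c + 4)])"

lemma complete_to_4:
  fixes i j k :: nat
  assumes "i < 4" "j < 4" "k < 4" "distinct [i, j, k]"
  shows "{i, j, k, 6 - i - j - k} = {..<4}"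
proof -
  have sub: "{i, j, k} \<subseteq> {..<4}" using assms by simp
  have "card {i, j, k} = 3" using assms(4) by simp
  then have "card ({..<4} - {i, j, k}) = 1"
    using sub by (subst card_Diff_subset) simp_all
  then obtain l where l: "{..<4} - {i, j, k} = {l}" by (rule card_1_singletonE)
  then have "l \<notin> {i, j, k}" by blast
  moreover from l sub have eq: "{..<4} = {i, j, k, l}" by blast
  then have "\<Sum>{..<4} = \<Sum>{i, j, k, l}" by simp
  ultimately have "i + j + k + l = 6"
    using assms(4) by (simp add: numeral_eq_Suc)
  then have "6 - i - j - k = l" by simp
  then show ?thesis using eq by simp
qed

lemma rainbow_colours:
  assumes "rainbow n q"
  shows "{q c, q (c + 2), q (c + 4), 6 - q c - q (c + 2) - q (c + 4)} = {..<4}"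
  using assms unfolding rainbow_def by (intro complete_to_4) blast+

text \<open>Cutting a cycle of length \<open>n\<close> into blocks coloured \<open>0, 1, 2, 3\<close> and \<open>0, 1, 2\<close> makes any
  three consecutive vertices differently coloured; the cycle to use here has steps of size 2.\<close>

lemma rainbow_exists:
  assumes "odd n" "n \<ge> 7"
  obtains q where "rainbow n q"
proof -
  obtain h where h: "n = 2 * h + 1" using assms by (elim oddE)
  \<comment> \<open>\<open>e\<close> is the number of blocks of length 4; what remains is divisible
    by 3.\<close>
  define e where "e = n mod 3"
  define g where "g t = (if t < 4 * e then t mod 4 else (t - 4 * e) mod 3)" for t :: nat
  \<comment> \<open>Multiplication by \<open>h + 1\<close>, the inverse of 2, turns steps of size 2
    in \<open>c\<close> into unit steps along the coloured cycle.\<close>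
  define q where "q c = g (row n (c * (int h + 1)))" for c
  have "n mod 3 < 3" by simp
  then have e: "e = 0 \<or> e = 1 \<or> e = 2" unfolding e_def by linarith
  define r where "r = n div 3"
  have r: "n = 3 * r + e" by (simp add: r_def e_def)
  \<comment> \<open>At least one block of length 3 has to remain. From 7 on only
    \<open>n = 8\<close> would violate this, and \<open>n\<close> is odd.\<close>
  have "r \<ge> e + 1"
  proof (rule ccontr)
    assume "\<not> r \<ge> e + 1"
    then have "r = 2" "e = 2" using r e assms(2) by auto
    then show False using r assms(1) by simp
  qed
  then obtain a where "r = e + 1 + a" using le_Suc_ex by blast
  then have a: "n = 4 * e + 3 * a + 3" using r by simp
  have n0: "n > 0" using assms(2) by simp
  define nx where "nx t = (if t + 1 = n then 0 else t + 1)" for t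
  have g: "distinct [g t, g (nx t), g (nx (nx t))]" if t: "t < n" for t
  proof (cases "t < 4 * e")
    case True
    then have "t + 1 \<noteq> n" "t + 1 + 1 \<noteq> n" using a by simp_all
    then have nx2: "nx t = t + 1" "nx (t + 1) = t + 2" by (simp_all add: nx_def)
    \<comment> \<open>The first block of length 3 also begins with 0, 1, so the pattern modulo 4
      extends two places beyond the blocks of length 4.\<close>
    have g4: "g i = i mod 4" if "i \<le> 4 * e + 1" for i
    proof (cases "i < 4 * e")
      case False
      with that have "i = 4 * e \<or> i = 4 * e + 1" by linarith
      then show ?thesis by (elim disjE) (simp_all add: g_def)
    qed (simp add: g_def)
    have "distinct [t mod 4, (t + 1) mod 4, (t + 2) mod 4]" by (simp add: mod_Suc)
    then show ?thesis
      using True unfolding nx2 by (simp only: g4)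
  next
    case False
    then obtain s where s: "t = 4 * e + s" using le_Suc_ex not_less by blast
    then have s1: "s + 1 \<le> 3 * a + 3" using t a by simp
    have g0: "g 0 = 0" "g 1 = 1" using e by (auto simp: g_def)
    have gs: "g (4 * e + i) = i mod 3" for i by (simp add: g_def)
    consider "s + 2 < 3 * a + 3" | "s + 2 = 3 * a + 3" | "s + 1 = 3 * a + 3"
      using s1 by linarith
    then show ?thesis
    proof cases
      case 1
      then have "t + 1 \<noteq> n" "4 * e + (s + 1) + 1 \<noteq> n" using a s by simp_all
      then have n12: "nx t = 4 * e + (s + 1)" "nx (4 * e + (s + 1)) = 4 * e + (s + 2)"
        using s by (simp_all add: nx_def)
      have "distinct [s mod 3, (s + 1) mod 3, (s + 2) mod 3]" by (simp add: mod_Suc)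
      then show ?thesis unfolding n12 gs unfolding s gs .
    next
      case 2
      then have "t + 1 \<noteq> n" "4 * e + (s + 1) + 1 = n" using a s by simp_all
      then have n12: "nx t = 4 * e + (s + 1)" "nx (4 * e + (s + 1)) = 0"
        using s by (simp_all add: nx_def)
      have "s = 1 + 3 * a" using 2 by simp
      then have "s mod 3 = 1" "(s + 1) mod 3 = 2" by (simp_all add: mod_Suc)
      then have "distinct [s mod 3, (s + 1) mod 3, 0]" by simp
      then show ?thesis unfolding n12 gs g0 unfolding s gs .
    next
      case 3
      then have "t + 1 = n" "0 + 1 \<noteq> n" using a s assms(2) by simp_all
      then have n12: "nx t = 0" "nx 0 = 1" by (simp_all add: nx_def)
      have "s = 2 + 3 * a" using 3 by simp
      then have "s mod 3 = 2" by (simp add: mod_Suc)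
      then have "distinct [s mod 3, 0, 1]" by simp
      then show ?thesis unfolding n12 g0 unfolding s gs .
    qed
  qed
  have step: "row n ((c + 2) * (int h + 1)) = nx (row n (c * (int h + 1)))" for c
  proof -
    let ?t = "row n (c * (int h + 1))"
    have "(c + 2) * (int h + 1) = c * (int h + 1) + 1 + int n"
      by (simp add: h algebra_simps)
    then have "row n ((c + 2) * (int h + 1)) = row n (c * (int h + 1) + 1)"
      unfolding row_def by (simp only: mod_add_self2)
    also have "\<dots> = row n (int ?t + 1)"
      using n0 by (simp add: row_def mod_simps)
    also have "\<dots> = nx ?t"
    proof (cases "?t + 1 = n")
      case True
      then have "int ?t + 1 = int n" by linarith
      then show ?thesis using True by (simp add: nx_def row_def)
    next
      case False
      have "?t < n" using n0 by simp
      then have "row n (int (?t + 1)) = ?t + 1" using False by (intro row_of_nat) simp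
      then show ?thesis using False by (simp add: nx_def ac_simps)
    qed
    finally show ?thesis .
  qed
  have "q (c mod int n) = q c" for c
    unfolding q_def by (rule arg_cong[of _ _ g]) (simp add: row_def mod_simps)
  moreover have "q c < 4" for c
  proof -
    have "t mod 4 < 4" "t mod 3 < 4" for t :: nat
      using mod_less_divisor[of 4 t] mod_less_divisor[of 3 t] by linarith+
    then show ?thesis by (simp add: q_def g_def)
  qed
  moreover have "distinct [q c, q (c + 2), q (c + 4)]" for c
  proof -
    let ?t = "row n (c * (int h + 1))"
    have "q (c + 2) = g (nx ?t)" unfolding q_def step ..
    moreover have "q (c + 2 + 2) = g (nx (nx ?t))" unfolding q_def step ..
    moreover have "c + 2 + 2 = c + 4" by simp
    ultimately show ?thesis using g[of ?t] n0 by (simp add: q_def)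
  qed
  ultimately have "rainbow n q" unfolding rainbow_def by blast
  then show thesis by (rule that)
qed

text \<open>The slots in \<open>e\<close> exchange their rows and all others stand still; \<open>6 = 0 + 1 + 2 + 3\<close>, so the
  last of the four slots gets the remaining colour.\<close>

definition buffer :: "(int \<Rightarrow> nat) \<Rightarrow> nat list \<Rightarrow> int \<Rightarrow> nat \<Rightarrow> nat" where
  "buffer q e c s =
    (if s = e ! 0 then e ! q c
     else if s = e ! 1 then e ! q (c + 2)
     else if s = e ! 2 then e ! q (c + 4)
     else if s = e ! 3 then e ! (6 - q c - q (c + 2) - q (c + 4))
     else s)"

lemma buffer_mod:
  assumes "rainbow n q"
  shows "buffer q e (c mod int n) s = buffer q e c s"
proof -
  have q: "q (y mod int n) = q y" for y
    using assms unfolding rainbow_def by blast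
  have "q (c mod int n + d) = q (c + d)" for d
    using q[of "c mod int n + d"] q[of "c + d"] by (simp add: mod_add_left_eq)
  from this[of 0] this[of 2] this[of 4] show ?thesis
    by (simp add: buffer_def)
qed

lemma length_4_cases:
  assumes "length e = 4"
  obtains e0 e1 e2 e3 where "e = [e0, e1, e2, e3]"
  using assms by (auto simp: numeral_eq_Suc length_Suc_conv)

lemma buffer_special:
  assumes "length e = 4" "distinct e"
  shows "buffer q e c (e ! 0) = e ! q c" "buffer q e c (e ! 1) = e ! q (c + 2)"
    "buffer q e c (e ! 2) = e ! q (c + 4)"
    "buffer q e c (e ! 3) = e ! (6 - q c - q (c + 2) - q (c + 4))"
    "s \<notin> set e \<Longrightarrow> buffer q e c s = s"
proof -
  obtain e0 e1 e2 e3 where e: "e = [e0, e1, e2, e3]" using assms(1) by (rule length_4_cases)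
  show "buffer q e c (e ! 0) = e ! q c" "buffer q e c (e ! 1) = e ! q (c + 2)"
    "buffer q e c (e ! 2) = e ! q (c + 4)"
    "buffer q e c (e ! 3) = e ! (6 - q c - q (c + 2) - q (c + 4))"
    using assms(2) by (simp_all add: buffer_def e)
  show "s \<notin> set e \<Longrightarrow> buffer q e c s = s"
    by (simp add: buffer_def e)
qed

lemma buffer_image:
  assumes q: "rainbow n q" and e: "length e = 4" "distinct e" "set e \<subseteq> {..<n}"
  shows "buffer q e c ` {..<n} = {..<n}"
proof -
  have set_e: "set e = (!) e ` {..<4}" using e(1) by (auto simp: set_conv_nth)
  have 4: "{..<4} = {0, 1, 2, 3::nat}" by auto
  have "buffer q e c ` set e = (!) e ` {q c, q (c + 2), q (c + 4), 6 - q c - q (c + 2) - q (c + 4)}"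
    unfolding set_e 4 image_image image_insert image_empty buffer_special(1-4)[OF e(1,2)] by simp
  also have "\<dots> = set e" unfolding rainbow_colours[OF q] set_e ..
  finally have "buffer q e c ` set e = set e" .
  moreover have "buffer q e c ` ({..<n} - set e) = {..<n} - set e"
    using buffer_special(5)[OF e(1,2)] by auto
  ultimately have "buffer q e c ` (set e \<union> ({..<n} - set e)) = set e \<union> ({..<n} - set e)"
    unfolding image_Un by (rule arg_cong2)
  moreover have "set e \<union> ({..<n} - set e) = {..<n}" using e(3) by blast
  ultimately show ?thesis by (simp only:)
qed

text \<open>Here \<open>E s \<omega>\<close> says that slot \<open>s\<close> has a neighbour which lies in a given row \<open>z\<close> exactly
  in the factor number \<open>z + \<omega>\<close>.\<close>

lemma buffer_cover:
  assumes q: "rainbow n q" and e: "length e = 4" "distinct e"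
    and plain: "\<And>s. s < n \<Longrightarrow> s \<notin> set e \<Longrightarrow> \<exists>\<omega>. E s \<omega>"
    and E3: "E (e ! 3) \<omega>0"
    and E012: "\<And>d. d \<in> {0, 1, 2} \<Longrightarrow>
      \<exists>i \<in> {0, 1, 2}. \<exists>\<omega>. E (e ! i) \<omega> \<and> (\<omega> + 2 * int i - \<omega>0 - 2 * int d) mod int n = 0"
    and v: "v < n"
  shows "\<exists>s \<omega>. E s \<omega> \<and> buffer q e (z + \<omega>) s = v"
proof (cases "v \<in> set e")
  case False
  from plain[OF v False] obtain \<omega> where "E v \<omega>" by (elim exE)
  moreover have "buffer q e (z + \<omega>) v = v" using False by (rule buffer_special(5)[OF e])
  ultimately show ?thesis by (intro exI conjI)
next
  case True
  let ?c = "z + \<omega>0"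
  from True e obtain k where k: "k < 4" "v = e ! k" by (auto simp: in_set_conv_nth)
  then have "k \<in> {q ?c, q (?c + 2), q (?c + 4), 6 - q ?c - q (?c + 2) - q (?c + 4)}"
    unfolding rainbow_colours[OF q] by simp
  \<comment> \<open>The wanted row has a colour \<open>k\<close>. If \<open>k\<close> is the colour
    at \<open>?c + 2 * d\<close>, then \<open>E012\<close> supplies a slot \<open>e ! i\<close> and
    a factor \<open>z + \<omega>\<close> with the same colour argument modulo \<open>n\<close>;
    otherwise \<open>k\<close> is the remaining colour and slot \<open>e ! 3\<close> serves.\<close>
  then have "(\<exists>d \<in> {0, 1, 2}. k = q (?c + 2 * int d)) \<or> k = 6 - q ?c - q (?c + 2) - q (?c + 4)"
    by simp
  then show ?thesis
  proof (elim disjE bexE)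
    fix d assume 1: "d \<in> {0, 1, 2}" "k = q (?c + 2 * int d)"
    obtain i where i: "i \<in> {0, 1, 2}"
      "\<exists>\<omega>. E (e ! i) \<omega> \<and> (\<omega> + 2 * int i - \<omega>0 - 2 * int d) mod int n = 0"
      using E012[OF 1(1)] by (elim bexE)
    from i(2) obtain \<omega> where w: "E (e ! i) \<omega>"
      "(\<omega> + 2 * int i - \<omega>0 - 2 * int d) mod int n = 0"
      by (elim exE conjE)
    have "(z + \<omega> + 2 * int i) mod int n = (?c + 2 * int d) mod int n"
      using w(2) by (simp add: mod_eq_dvd_iff mod_eq_0_iff_dvd algebra_simps)
    moreover have per: "q (y mod int n) = q y" for y
      using q unfolding rainbow_def by blast
    ultimately have "q (z + \<omega> + 2 * int i) = q (?c + 2 * int d)"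
      using per[of "z + \<omega> + 2 * int i"] per[of "?c + 2 * int d"] by simp
    then have "q (z + \<omega> + 2 * int i) = k"
      unfolding 1(2) .
    moreover have "buffer q e (z + \<omega>) (e ! i) = e ! q (z + \<omega> + 2 * int i)"
      using i(1) buffer_special[OF e] by auto
    ultimately have "buffer q e (z + \<omega>) (e ! i) = v"
      unfolding k(2) by simp
    then show ?thesis using w(1) by blast
  next
    assume "k = 6 - q ?c - q (?c + 2) - q (?c + 4)"
    then have "buffer q e (z + \<omega>0) (e ! 3) = v"
      unfolding buffer_special(4)[OF e] k(2) by simp
    then show ?thesis using E3 by blast
  qed
qed

section \<open>Covering the edges between two adjacent columns\<close>

lemma row_shift: "row n (a + \<epsilon> * int (row n d)) = row n (a + \<epsilon> * d)" if "n > 0"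
proof -
  have "(a + \<epsilon> * (d mod int n)) mod int n = (a + \<epsilon> * d) mod int n"
    by (intro mod_add_cong mod_mult_right_eq refl)
  then show ?thesis
    unfolding int_row[OF that] unfolding row_def by (simp only:)
qed

text \<open>As the two columns move in opposite directions, the sum of the two rows does not depend
  on \<open>c\<close>. So \<open>c\<close> can be chosen to fit the first row, and the second
  follows from the sum.\<close>

lemma cover_sum:
  assumes "n > 0" and \<epsilon>: "\<epsilon> * \<epsilon> = (1::int)" and i: "i < n" "i' < n"
    and E: "E s t" "(lab s + lab' t - int i - int i') mod int n = 0"
  shows "\<exists>c < n. \<exists>s t. E s t \<and> row n (lab s + \<epsilon> * int c) = i \<and> row n (lab' t + - \<epsilon> * int c) = i'"
proof -
  define c where "c = row n (\<epsilon> * (int i - lab s))"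
  have e: "\<epsilon> * (\<epsilon> * y) = y" "- \<epsilon> * (\<epsilon> * y) = - y" for y
    using \<epsilon> by (simp_all add: mult.assoc[symmetric])
  have "row n (lab s + \<epsilon> * int c) = row n (int i)"
    unfolding c_def row_shift[OF assms(1)] e by simp
  moreover have "row n (lab' t + - \<epsilon> * int c) = row n (lab' t + lab s - int i)"
    unfolding c_def row_shift[OF assms(1)] e by (simp add: algebra_simps)
  moreover have "row n (lab' t + lab s - int i) = i'"
    using i E(2) by (intro row_eqI) (auto simp: algebra_simps)
  ultimately have "row n (lab s + \<epsilon> * int c) = i" "row n (lab' t + - \<epsilon> * int c) = i'"
    using i by (simp_all add: row_of_nat)
  moreover have "c < n" using assms(1) by (simp add: c_def)
  ultimately show ?thesis using E(1) by blast
qed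

text \<open>The row \<open>i'\<close> in the moving column determines the factor as
  \<open>\<epsilon> * (i' - lab t)\<close>; periodicity of \<open>B\<close> allows its evaluation at
  this unreduced integer.\<close>

lemma cover_still:
  assumes "n > 0" and \<epsilon>: "\<epsilon> * \<epsilon> = (1::int)" and i': "i' < n"
    and B: "\<And>c s. B (c mod int n) s = B c s"
    and E: "E s t" "B (\<epsilon> * int i' + - \<epsilon> * lab t) s = v"
  shows "\<exists>c < n. \<exists>s t. E s t \<and> B (int c) s = v \<and> row n (lab t + \<epsilon> * int c) = i'"
proof -
  define c where "c = row n (\<epsilon> * int i' + - \<epsilon> * lab t)"
  have e: "\<epsilon> * (\<epsilon> * int i' + - \<epsilon> * lab t) = int i' - lab t"
    using \<epsilon> by (simp add: algebra_simps flip: mult.assoc)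
  have "row n (lab t + \<epsilon> * int c) = i'"
    unfolding c_def row_shift[OF assms(1)] e using i' by (simp add: row_of_nat)
  moreover have "B (int c) s = v"
    unfolding c_def int_row[OF assms(1)] B E(2) ..
  moreover have "c < n" using assms(1) by (simp add: c_def)
  ultimately show ?thesis using E(1) by blast
qed

text \<open>A neighbour \<open>t\<close> in the moving column lies in row \<open>i'\<close> exactly
  in the factor \<open>\<epsilon> * i' - \<epsilon> * lab t\<close>, so \<open>buffer_cover\<close>
  applies with \<open>z = \<epsilon> * i'\<close> and
  \<open>\<omega> = - \<epsilon> * lab t\<close>.\<close>

lemma cover_buffer:
  assumes q: "rainbow n q" and e: "length e = 4" "distinct e" and \<epsilon>: "\<epsilon> * \<epsilon> = (1::int)"
    and plain: "\<And>s. s < n \<Longrightarrow> s \<notin> set e \<Longrightarrow> \<exists>t. E s t"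
    and E3: "E (e ! 3) t3"
    and E012: "\<And>d. d \<in> {0, 1, 2} \<Longrightarrow>
      \<exists>i \<in> {0, 1, 2}. \<exists>t. E (e ! i) t \<and>
        (- \<epsilon> * lab t + 2 * int i - (- \<epsilon> * lab t3) - 2 * int d) mod int n = 0"
    and v: "v < n" "i' < n"
  shows "\<exists>c < n. \<exists>s t. E s t \<and> buffer q e (int c) s = v \<and> row n (lab t + \<epsilon> * int c) = i'"
proof -
  let ?H = "\<lambda>s \<omega>. \<exists>t. E s t \<and> \<omega> = - \<epsilon> * lab t"
  have "\<exists>s \<omega>. ?H s \<omega> \<and> buffer q e (\<epsilon> * int i' + \<omega>) s = v"
  proof (rule buffer_cover[OF q e, where E = ?H and ?\<omega>0.0 = "- \<epsilon> * lab t3"])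
    show "\<exists>\<omega> t. E s t \<and> \<omega> = - \<epsilon> * lab t" if "s < n" "s \<notin> set e" for s
      using plain[OF that] by blast
    show "\<exists>t. E (e ! 3) t \<and> - \<epsilon> * lab t3 = - \<epsilon> * lab t"
      using E3 by blast
    show "\<exists>i\<in>{0, 1, 2}. \<exists>\<omega>. (\<exists>t. E (e ! i) t \<and> \<omega> = - \<epsilon> * lab t) \<and>
        (\<omega> + 2 * int i - - \<epsilon> * lab t3 - 2 * int d) mod int n = 0" if d: "d \<in> {0, 1, 2}" for d
    proof -
      obtain i where i: "i \<in> {0, 1, 2}" "\<exists>t. E (e ! i) t \<and>
          (- \<epsilon> * lab t + 2 * int i - (- \<epsilon> * lab t3) - 2 * int d) mod int n = 0"
        using E012[OF d] by (elim bexE)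
      from i(2) obtain t where "E (e ! i) t"
          "(- \<epsilon> * lab t + 2 * int i - (- \<epsilon> * lab t3) - 2 * int d) mod int n = 0"
        by (elim exE conjE)
      then show ?thesis
        by (intro bexI[OF _ i(1)] exI[of _ "- \<epsilon> * lab t"] conjI exI[of _ t] refl)
    qed
    show "v < n" by fact
  qed
  then obtain s t where st: "E s t" "buffer q e (\<epsilon> * int i' + - \<epsilon> * lab t) s = v"
    by (elim exE conjE) simp
  show ?thesis
    by (rule cover_still[where E = E and B = "buffer q e" and s = s and t = t])
      (use v \<epsilon> st buffer_mod[OF q] in simp_all)
qed

section \<open>One still column\<close>

text \<open>The direction in which the slots of a moving column shift as the factor number
  grows.\<close>

definition parity_sign :: "nat \<Rightarrow> int" where
  "parity_sign x = (if even x then 1 else - 1)"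

lemma parity_sign_square: "parity_sign x * parity_sign x = 1"
  by (simp add: parity_sign_def)

lemma parity_sign_Suc: "parity_sign (x + 1) = - parity_sign x"
  by (simp add: parity_sign_def)

section \<open>Neighbours of the slots of column 0\<close>

context
  fixes m b n :: nat
  assumes m: "m \<ge> 3" and n: "n = m + 2 * b"
begin

lemma mod_wrap: "(0 + 1) mod m = 1" "(m - 1 + 1) mod m = 0"
  using m by simp_all

text \<open>The rewiring changes only visits outside column 0. Within column 0 the even slots up to
  \<open>2 * b\<close> stay on cycle \<open>0\<close>, and the odd ones up to
  \<open>2 * b + 1\<close> on cycle \<open>m - 1\<close>.\<close>

lemma layout_even:
  assumes "k \<le> 2 * b" "even k"
  shows "layout m b 0 k = (0, k)"
proof -
  have "k mod 4 \<noteq> 1" "k mod 4 \<noteq> 3" "k mod 2 = 0" using assms(2) by presburger+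
  then show ?thesis using assms(1) m by (simp add: layout_def climb_def)
qed

lemma layout_odd:
  assumes "k \<le> 2 * b + 1" "odd k"
  shows "layout m b (m - 1) k = (0, k)"
proof -
  have "k mod 4 \<noteq> 2" "k mod 2 = 1" using assms(2) by presburger+
  moreover have "k \<le> 2 * b \<or> k = 2 * b + 1" using assms(1) by linarith
  ultimately have "climb b k = 1" by (auto simp: climb_def)
  with \<open>k mod 4 \<noteq> 2\<close> show ?thesis using m by (simp add: layout_def)
qed

lemma column_0_left_0: "gap_edge (layout m b) m n (m - 1) (n - 1) 0"
  using gap_edge_straight[OF m n, of "m - 1" "n - 1"] m n by simp

lemma column_0_right_0:
  assumes "k < n" "2 * b < k"
  shows "gap_edge (layout m b) m n 0 k ((k + 1) mod n)"
  using gap_edge_straight[OF m n, of 0 k] m assms by simp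

lemma column_0_left_large:
  assumes "k < n" "2 * b < k"
  shows "\<exists>t. gap_edge (layout m b) m n (m - 1) t k"
proof (cases "k = 2 * b + 1")
  case True
  \<comment> \<open>Slot \<open>2 * b + 1\<close> is entered by the last step of the alternating
    part, not by a straight step.\<close>
  have "layout m b (m - 1) (2 * b) = (m - 1, 2 * b)"
    using m by (subst layout_std) (auto simp: climb_def)
  moreover have "layout m b (m - 1) ((2 * b + 1) mod n) = (0, k)"
    using layout_odd[of k] True assms m n by simp
  ultimately have "gap_edge (layout m b) m n (m - 1) (2 * b) k"
    using m n mod_wrap by (intro gap_edgeI[of "m - 1" _ "2 * b"]) auto
  then show ?thesis by blast
next
  case False
  then have "gap_edge (layout m b) m n (m - 1) (k - 1) ((k - 1 + 1) mod n)"
    using assms m by (intro gap_edge_straight[OF m n]) auto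
  then show ?thesis using assms by auto
qed

text \<open>The \<open>b div 2\<close> rewired blocks have four steps each. In a block cycle
  \<open>0\<close> visits the columns \<open>0, 1, 0, m - 1, 0\<close> and cycle
  \<open>m - 1\<close> visits \<open>m - 1, 0, 1, 0, m - 1\<close>, so column 0 is always passed
  through.\<close>

lemma layout_block:
  assumes d: "d < b div 2"
  shows "layout m b 0 (4 * d) = (0, 4 * d)" "layout m b 0 (4 * d + 1) = (1, 4 * d + 3)"
    "layout m b 0 (4 * d + 2) = (0, 4 * d + 2)" "layout m b 0 (4 * d + 3) = (m - 1, 4 * d + 2)"
    "layout m b 0 (4 * d + 4) = (0, 4 * d + 4)"
    "layout m b (m - 1) (4 * d) = (m - 1, 4 * d)" "layout m b (m - 1) (4 * d + 1) = (0, 4 * d + 1)"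
    "layout m b (m - 1) (4 * d + 2) = (1, 4 * d + 1)" "layout m b (m - 1) (4 * d + 3) = (0, 4 * d + 3)"
    "layout m b (m - 1) (4 * d + 4) = (m - 1, 4 * d + 4)"
proof -
  define K where "K = 4 * (b div 2)"
  have K: "4 * d + 4 \<le> K" "K \<le> 2 * b" using d by (simp_all add: K_def)
  note L = layout_def[of m b, folded K_def]
  have r: "(4 * d + r) mod 4 = r mod 4" for r by simp
  have cl: "climb b k = k mod 2" if "k \<le> 4 * d + 4" for k
    using that K by (simp add: climb_def)
  have p: "(4 * d) mod 2 = 0" "(4 * d + 1) mod 2 = 1" "(4 * d + 2) mod 2 = 0" "(4 * d + 3) mod 2 = 1"
    "(4 * d + 4) mod 2 = 0"
    by presburger+
  have m': "m - 1 \<noteq> 0" "(m - 1 + 1) mod m = 0" "(m - 1 + 0) mod m = m - 1" using m by auto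
  show "layout m b 0 (4 * d) = (0, 4 * d)" "layout m b 0 (4 * d + 2) = (0, 4 * d + 2)"
    "layout m b 0 (4 * d + 4) = (0, 4 * d + 4)"
    using K by (intro layout_even; simp)+
  show "layout m b (m - 1) (4 * d + 1) = (0, 4 * d + 1)" "layout m b (m - 1) (4 * d + 3) = (0, 4 * d + 3)"
    using K by (intro layout_odd; simp)+
  show "layout m b 0 (4 * d + 1) = (1, 4 * d + 3)"
    using K r[of 1] by (simp add: L)
  show "layout m b 0 (4 * d + 3) = (m - 1, 4 * d + 2)"
    using K r[of 3] by (simp add: L)
  show "layout m b (m - 1) (4 * d + 2) = (1, 4 * d + 1)"
    using K r[of 2] m' by (simp add: L)
  show "layout m b (m - 1) (4 * d) = (m - 1, 4 * d)"
    using cl[of "4 * d"] p m' by (subst layout_std) auto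
  show "layout m b (m - 1) (4 * d + 4) = (m - 1, 4 * d + 4)"
    using cl[of "4 * d + 4"] p m' r[of 4] by (subst layout_std) auto
qed

text \<open>The edges at column 0 read off from the two walks through a block. Beyond their
  existence, the exact neighbouring slots matter for the colour conditions in the case of odd
  \<open>b\<close>.\<close>

lemma column_0_block:
  assumes d: "d < b div 2"
  shows "gap_edge (layout m b) m n 0 (4 * d) (4 * d + 3)"
    "gap_edge (layout m b) m n 0 (4 * d + 1) (4 * d + 1)"
    "gap_edge (layout m b) m n 0 (4 * d + 2) (4 * d + 3)"
    "gap_edge (layout m b) m n 0 (4 * d + 3) (4 * d + 1)"
    "gap_edge (layout m b) m n (m - 1) (4 * d) (4 * d + 1)"
    "gap_edge (layout m b) m n (m - 1) (4 * d + 2) (4 * d + 2)"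
    "gap_edge (layout m b) m n (m - 1) (4 * d + 4) (4 * d + 3)"
    "gap_edge (layout m b) m n (m - 1) (4 * d + 2) (4 * d + 4)"
proof -
  have "4 * d + 4 \<le> 2 * b" using d by linarith
  then have k: "4 * d < n" "4 * d + 1 < n" "4 * d + 2 < n" "4 * d + 3 < n"
    and nn: "(4 * d + 1) mod n = 4 * d + 1" "(4 * d + 1 + 1) mod n = 4 * d + 2"
      "(4 * d + 2 + 1) mod n = 4 * d + 3" "(4 * d + 3 + 1) mod n = 4 * d + 4"
    using n m by simp_all
  have m1: "0 < m" "m - 1 < m" using m by simp_all
  note S = nn layout_block[OF d] mod_wrap
  show "gap_edge (layout m b) m n 0 (4 * d) (4 * d + 3)"
    by (rule gap_edgeI[OF m1(1) k(1)]) (simp_all only: S)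
  show "gap_edge (layout m b) m n 0 (4 * d + 1) (4 * d + 1)"
    by (rule gap_edgeI[OF m1(2) k(2)]) (simp_all only: S)
  show "gap_edge (layout m b) m n 0 (4 * d + 2) (4 * d + 3)"
    by (rule gap_edgeI'[OF m1(1) k(2)]) (simp_all only: S)
  show "gap_edge (layout m b) m n 0 (4 * d + 3) (4 * d + 1)"
    by (rule gap_edgeI'[OF m1(2) k(3)]) (simp_all only: S)
  show "gap_edge (layout m b) m n (m - 1) (4 * d) (4 * d + 1)"
    by (rule gap_edgeI[OF m1(2) k(1)]) (simp_all only: S)
  show "gap_edge (layout m b) m n (m - 1) (4 * d + 2) (4 * d + 2)"
    by (rule gap_edgeI'[OF m1(1) k(3)]) (simp_all only: S)
  show "gap_edge (layout m b) m n (m - 1) (4 * d + 4) (4 * d + 3)"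
    by (rule gap_edgeI'[OF m1(2) k(4)]) (simp_all only: S)
  show "gap_edge (layout m b) m n (m - 1) (4 * d + 2) (4 * d + 4)"
    by (rule gap_edgeI[OF m1(1) k(4)]) (simp_all only: S)
qed

text \<open>For odd \<open>b\<close> the cycles turn around at the slots \<open>2 * b - 1\<close> and \<open>2 * b\<close> of column 0.\<close>

lemma column_0_through:
  assumes s: "s < n" and through: "odd b \<Longrightarrow> s \<noteq> 2 * b - 1 \<and> s \<noteq> 2 * b"
  shows "\<exists>t. gap_edge (layout m b) m n 0 s t" "\<exists>t. gap_edge (layout m b) m n (m - 1) t s"
proof -
  define d where "d = b div 2"
  have b: "b = 2 * d + b mod 2" by (simp add: d_def)
  \<comment> \<open>The rewired blocks end before slot \<open>4 * d\<close>. This is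
    \<open>2 * b\<close> for even \<open>b\<close> and \<open>2 * b - 2\<close> for odd
    \<open>b\<close>, where the two slots after it are excluded by assumption.\<close>
  consider "s > 2 * b" | "s = 4 * d" | i where "i < d" "s = 4 * i \<or> s = 4 * i + 1 \<or> s = 4 * i + 2 \<or> s = 4 * i + 3"
  proof (cases "s < 4 * d")
    case True
    have "s = 4 * (s div 4) + s mod 4" by simp
    moreover have "s div 4 < d" using True by (simp add: div_less_iff_less_mult mult.commute)
    ultimately show thesis using that(3)[of "s div 4"] by (cases s rule: mod_4_cases) simp_all
  next
    case False
    show thesis
    proof (cases "odd b")
      case True
      then have "b = 2 * d + 1" using b by presburger
      then show thesis using False that(1,2) through True by fastforce
    next
      case even: False
      then have "b = 2 * d" using b by presburger
      then show thesis using False that(1,2) by fastforce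
    qed
  qed
  then have "(\<exists>t. gap_edge (layout m b) m n 0 s t) \<and> (\<exists>t. gap_edge (layout m b) m n (m - 1) t s)"
  proof cases
    case 1
    then show ?thesis using column_0_right_0[OF s] column_0_left_large[OF s] by blast
  next
    case 2
    have "4 * d \<le> 2 * b" using b by linarith
    then have "gap_edge (layout m b) m n 0 s (s + 1)"
    proof -
      have "layout m b 0 (s + 1) = (1, s + 1)"
        using 2 b m \<open>4 * d \<le> 2 * b\<close> by (subst layout_std) (auto simp: d_def climb_def mod_Suc)
      moreover have "layout m b 0 s = (0, s)" using 2 \<open>4 * d \<le> 2 * b\<close> by (intro layout_even) auto
      moreover have "(s + 1) mod n = s + 1" using 2 \<open>4 * d \<le> 2 * b\<close> m n by simp
      ultimately show ?thesis using s m mod_wrap by (intro gap_edgeI[of 0 _ s]) auto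
    qed
    moreover have "\<exists>t. gap_edge (layout m b) m n (m - 1) t s"
    proof (cases "d = 0")
      case True
      then show ?thesis using column_0_left_0 2 by auto
    next
      case False
      then have "gap_edge (layout m b) m n (m - 1) (4 * (d - 1) + 2) (4 * (d - 1) + 4)"
        by (intro column_0_block) (simp add: d_def[symmetric])
      moreover have "4 * (d - 1) + 4 = s" using False 2 by simp
      ultimately show ?thesis by auto
    qed
    ultimately show ?thesis by blast
  next
    case 3
    have i: "i < b div 2" using 3(1) by (simp add: d_def)
    \<comment> \<open>Slot \<open>4 * i\<close> is entered from the preceding block, or for
      \<open>i = 0\<close> by the closing edge of cycle \<open>0\<close>.\<close>
    have "\<exists>t. gap_edge (layout m b) m n (m - 1) t (4 * i)"
    proof (cases "i = 0")
      case True
      then show ?thesis using column_0_left_0 by auto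
    next
      case False
      then have "gap_edge (layout m b) m n (m - 1) (4 * (i - 1) + 2) (4 * (i - 1) + 4)"
        using i by (intro column_0_block) simp
      moreover have "4 * (i - 1) + 4 = 4 * i" using False by simp
      ultimately show ?thesis by auto
    qed
    then show ?thesis using 3(2) column_0_block[OF i] by (elim disjE) blast+
  qed
  then show "\<exists>t. gap_edge (layout m b) m n 0 s t" "\<exists>t. gap_edge (layout m b) m n (m - 1) t s"
    by blast+
qed

end

section \<open>Factorizations with column 0 still\<close>

context
  fixes m b n :: nat
  assumes m: "m \<ge> 3" and n: "n = m + 2 * b" and odd_m: "odd m"
begin

lemma n_props: "n > 0" "odd n" "n \<ge> 3"
  using m n odd_m by simp_all

lemma cover_consecutive:
  assumes x: "0 < x" "x < m - 1" and i: "i < n" "i' < n"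
  shows "\<exists>c < n. \<exists>s t. gap_edge (layout m b) m n x s t \<and>
    row n (int s + parity_sign x * int c) = i \<and> row n (int t + parity_sign (x + 1) * int c) = i'"
proof -
  \<comment> \<open>The edge sought joins the slots \<open>k\<close> and \<open>k + 1\<close> with
    sum \<open>i + i'\<close> modulo \<open>n\<close>.\<close>
  obtain k where k: "k < n" "(2 * int k - (int i + int i' - 1)) mod int n = 0"
    using n_props(2) by (rule halve)
  let ?k = "(k + 1) mod n"
  have "(int k + int ?k - int i - int i') mod int n = (int k + int (k + 1) - int i - int i') mod int n"
    unfolding of_nat_mod by (intro mod_diff_cong mod_add_right_eq refl)
  also have "\<dots> = 0" using k(2) by (simp add: algebra_simps)
  finally have sum: "(int k + int ?k - int i - int i') mod int n = 0" .
  obtain s t where st: "gap_edge (layout m b) m n x s t" "(int s + int t - int i - int i') mod int n = 0"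
    using gap_edge_consecutive[OF m n x k(1)] sum by (metis add.commute)
  show ?thesis
    unfolding parity_sign_Suc
    by (rule cover_sum[where E = "gap_edge (layout m b) m n x" and lab = int and lab' = int])
      (use n_props parity_sign_square i st in simp_all)
qed

text \<open>The gaps between moving columns are settled by \<open>cover_consecutive\<close>, so only
  the two gaps at column 0 remain. Their other columns move in the directions \<open>- 1\<close> for
  column 1 and \<open>1\<close> for column \<open>m - 1\<close>, as \<open>m\<close> is odd.\<close>

lemma factorization_one_still_column:
  assumes B: "\<And>c. B c ` {..<n} = {..<n}"
    and right: "\<And>v i'. v < n \<Longrightarrow> i' < n \<Longrightarrow> \<exists>c < n. \<exists>s t. gap_edge (layout m b) m n 0 s t \<and>
      B (int c) s = v \<and> row n (int t + - 1 * int c) = i'"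
    and left: "\<And>v i'. v < n \<Longrightarrow> i' < n \<Longrightarrow> \<exists>c < n. \<exists>s t. gap_edge (layout m b) m n (m - 1) t s \<and>
      B (int c) s = v \<and> row n (int t + 1 * int c) = i'"
  shows "(\<exists>P. cycle_factorization n (cycle_blowup m n) P) \<and> (0, n) \<in> HWP (cycle_blowup m n) m n"
proof (rule factorization_from_arrays[OF m n_props(3) layout_image[OF m n] layout_adjacent[OF m n]])
  let ?L = "\<lambda>x c s. if x = 0 then B (int c) s else row n (int s + parity_sign x * int c)"
  show "?L x c ` {..<n} = {..<n}" if "x < m" "c < n" for x c
    using B row_image[of n "\<lambda>s. s"] n_props by simp
  show "\<exists>c < n. \<exists>s t. gap_edge (layout m b) m n x s t \<and> ?L x c s = i \<and> ?L ((x + 1) mod m) c t = i'"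
    if x: "x < m" "i < n" "i' < n" for x i i'
  proof -
    consider "x = 0" | "x = m - 1" "x \<noteq> 0" | "0 < x" "x < m - 1" using x(1) m by linarith
    then show ?thesis
    proof cases
      case 1
      then show ?thesis using right[OF x(2,3)] m by (simp add: parity_sign_def)
    next
      case 2
      moreover have "parity_sign (m - 1) = 1" "(m - 1 + 1) mod m = 0"
        using odd_m m by (simp_all add: parity_sign_def)
      ultimately show ?thesis using left[OF x(3,2)] by auto
    next
      case 3
      moreover have "(x + 1) mod m = x + 1" using 3 by simp
      ultimately show ?thesis using cover_consecutive[OF 3 x(2,3)] by simp
    qed
  qed
qed

text \<open>No rows are exchanged: every slot of column 0 has a neighbour on either side, which runs
  through all rows as the factor varies.\<close>

lemma factorization_even:
  assumes b: "even b"
  shows "(\<exists>P. cycle_factorization n (cycle_blowup m n) P) \<and> (0, n) \<in> HWP (cycle_blowup m n) m n"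
proof (rule factorization_one_still_column[where B = "\<lambda>_ s. s"])
  fix v i' assume v: "v < n" "i' < n"
  from column_0_through[OF m n v(1)] b obtain t t'
    where t: "gap_edge (layout m b) m n 0 v t" "gap_edge (layout m b) m n (m - 1) t' v"
    by auto
  show "\<exists>c < n. \<exists>s t. gap_edge (layout m b) m n 0 s t \<and> s = v \<and> row n (int t + - 1 * int c) = i'"
    by (rule cover_still[where E = "gap_edge (layout m b) m n 0" and B = "\<lambda>_ s. s" and lab = int])
      (use n_props v t in simp_all)
  show "\<exists>c < n. \<exists>s t. gap_edge (layout m b) m n (m - 1) t s \<and> s = v \<and> row n (int t + 1 * int c) = i'"
    by (rule cover_still[where E = "\<lambda>s t. gap_edge (layout m b) m n (m - 1) t s" and B = "\<lambda>_ s. s" and lab = int])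
      (use n_props v t in simp_all)
qed simp

text \<open>Here \<open>2 * b = 4 * d + 6\<close>. In column 0, slot \<open>4 * d + 6\<close> has
  both neighbours on the right and slot \<open>4 * d + 5\<close> both on the left.\<close>

lemma column_0_turns:
  assumes b: "b = 2 * d + 3"
  shows "gap_edge (layout m b) m n 0 (4 * d + 6) (4 * d + 5)"
    "gap_edge (layout m b) m n 0 (4 * d + 6) (4 * d + 7)"
    "gap_edge (layout m b) m n (m - 1) (4 * d + 4) (4 * d + 5)"
    "gap_edge (layout m b) m n (m - 1) (4 * d + 6) (4 * d + 5)"
proof -
  have K: "4 * (b div 2) = 4 * d + 4" using b by simp
  have k: "4 * d + 4 < n" "4 * d + 5 < n" "4 * d + 6 < n"
    and nn: "(4 * d + 4 + 1) mod n = 4 * d + 5" "(4 * d + 5 + 1) mod n = 4 * d + 6"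
      "(4 * d + 6 + 1) mod n = 4 * d + 7"
    using n b m by simp_all
  have cl: "climb b (4 * d + 4) = 0" "climb b (4 * d + 5) = 1" "climb b (4 * d + 6) = 0"
    "climb b (4 * d + 7) = 1"
    using b by (simp_all add: climb_def; presburger)+
  have "(m - 1 + 0) mod m = m - 1" "(m - 1 + 1) mod m = 0" "(0 + 0) mod m = 0" "(0 + 1) mod m = 1"
    using m by simp_all
  then have L: "layout m b 0 (4 * d + 5) = (1, 4 * d + 5)" "layout m b 0 (4 * d + 6) = (0, 4 * d + 6)"
    "layout m b 0 (4 * d + 7) = (1, 4 * d + 7)"
    "layout m b (m - 1) (4 * d + 4) = (m - 1, 4 * d + 4)" "layout m b (m - 1) (4 * d + 5) = (0, 4 * d + 5)"
    "layout m b (m - 1) (4 * d + 6) = (m - 1, 4 * d + 6)"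
    using cl m by (subst layout_std; simp add: K)+
  have m1: "0 < m" "m - 1 < m" using m by simp_all
  note S = nn L mod_wrap[OF m n]
  show "gap_edge (layout m b) m n 0 (4 * d + 6) (4 * d + 5)"
    by (rule gap_edgeI'[OF m1(1) k(2)]) (simp_all only: S)
  show "gap_edge (layout m b) m n 0 (4 * d + 6) (4 * d + 7)"
    by (rule gap_edgeI[OF m1(1) k(3)]) (simp_all only: S)
  show "gap_edge (layout m b) m n (m - 1) (4 * d + 4) (4 * d + 5)"
    by (rule gap_edgeI[OF m1(2) k(1)]) (simp_all only: S)
  show "gap_edge (layout m b) m n (m - 1) (4 * d + 6) (4 * d + 5)"
    by (rule gap_edgeI'[OF m1(2) k(2)]) (simp_all only: S)
qed

lemma factorization_odd:
  assumes b: "b = 2 * d + 3"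
  shows "(\<exists>P. cycle_factorization n (cycle_blowup m n) P) \<and> (0, n) \<in> HWP (cycle_blowup m n) m n"
proof -
  have "odd n" "n \<ge> 7" using n_props n m b by simp_all
  then obtain q where q: "rainbow n q" by (rule rainbow_exists)
  \<comment> \<open>The two turning slots exchange rows with two slots of the last rewired block.
    The order is chosen so that, for the three edges at the first three slots on one side, the
    shifts \<open>\<omega> + 2 * i\<close> are the shift of the fourth slot plus 0, 2 and 4.\<close>
  let ?e = "[4 * d + 6, 4 * d + 1, 4 * d + 5, 4 * d + 2]"
  have e: "length ?e = 4" "distinct ?e" by simp_all
  have d: "d < b div 2" using b by simp
  have through: "(\<exists>t. gap_edge (layout m b) m n 0 s t) \<and> (\<exists>t. gap_edge (layout m b) m n (m - 1) t s)"
    if "s < n" "s \<notin> set ?e" for s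
    using column_0_through[OF m n that(1)] that(2) b by simp
  note R = column_0_block[OF m n d] column_0_turns[OF b]
  show ?thesis
  proof (rule factorization_one_still_column[where B = "buffer q ?e"])
    show "buffer q ?e c ` {..<n} = {..<n}" for c
      by (rule buffer_image[OF q e]) (use n b m in simp)
    fix v i' assume v: "v < n" "i' < n"
    show "\<exists>c < n. \<exists>s t. gap_edge (layout m b) m n 0 s t \<and> buffer q ?e (int c) s = v \<and>
        row n (int t + - 1 * int c) = i'"
    proof (rule cover_buffer[OF q e, where E = "gap_edge (layout m b) m n 0" and lab = int
          and ?t3.0 = "4 * d + 3"])
      show "\<exists>i \<in> {0, 1, 2}. \<exists>t. gap_edge (layout m b) m n 0 (?e ! i) t \<and>
          (- (- 1) * int t + 2 * int i - (- (- 1) * int (4 * d + 3)) - 2 * int j) mod int n = 0"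
        if "j \<in> {0, 1, 2}" for j
      proof -
        from that consider "j = 0" | "j = 1" | "j = 2" by blast
        then show ?thesis
        proof cases
          case 1
          then show ?thesis using R(2) by (intro bexI[of _ 1] exI[of _ "4 * d + 1"]) simp_all
        next
          case 2
          then show ?thesis using R(9) by (intro bexI[of _ 0] exI[of _ "4 * d + 5"]) simp_all
        next
          case 3
          then show ?thesis using R(10) by (intro bexI[of _ 0] exI[of _ "4 * d + 7"]) simp_all
        qed
      qed
    qed (use R(3) through v in simp_all)
    show "\<exists>c < n. \<exists>s t. gap_edge (layout m b) m n (m - 1) t s \<and> buffer q ?e (int c) s = v \<and>
        row n (int t + 1 * int c) = i'"
    proof (rule cover_buffer[OF q e, where E = "\<lambda>s t. gap_edge (layout m b) m n (m - 1) t s"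
          and lab = int and ?t3.0 = "4 * d + 2"])
      show "\<exists>i \<in> {0, 1, 2}. \<exists>t. gap_edge (layout m b) m n (m - 1) t (?e ! i) \<and>
          (- 1 * int t + 2 * int i - (- 1 * int (4 * d + 2)) - 2 * int j) mod int n = 0"
        if "j \<in> {0, 1, 2}" for j
      proof -
        from that consider "j = 0" | "j = 1" | "j = 2" by blast
        then show ?thesis
        proof cases
          case 1
          then show ?thesis using R(12) by (intro bexI[of _ 2] exI[of _ "4 * d + 6"]) simp_all
        next
          case 2
          then show ?thesis using R(11) by (intro bexI[of _ 2] exI[of _ "4 * d + 4"]) simp_all
        next
          case 3
          then show ?thesis using R(5) by (intro bexI[of _ 1] exI[of _ "4 * d"]) simp_all
        qed
      qed
    qed (use R(6) through v in simp_all)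
  qed
qed

end

section \<open>Two still columns\<close>

definition swap_1_2 :: "nat \<Rightarrow> nat" where
  "swap_1_2 i = (if i = 1 then 2 else if i = 2 then 1 else i)"

lemma row_of_nat_diff: "i < n \<Longrightarrow> z = int i - int n \<Longrightarrow> row n z = i"
  by (simp add: row_def)

text \<open>The straight parts of the cycles keep their label, so the labels of column \<open>x\<close> are those of
  column 0 shifted by \<open>x\<close>. Interchanging the labels 1 and 2 does not affect the sums between the
  columns \<open>3, \<dots>, m - 1\<close>, but it is what makes the labels next to the still columns fit.\<close>

definition twisted_label :: "nat \<Rightarrow> nat \<Rightarrow> nat \<Rightarrow> int" where
  "twisted_label n x s = int (swap_1_2 (row n (int s - int x))) + int x"

lemma swap_1_2_idem: "swap_1_2 (swap_1_2 i) = i"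
  by (simp add: swap_1_2_def)

lemma swap_1_2_less: "n \<ge> 3 \<Longrightarrow> i < n \<Longrightarrow> swap_1_2 i < n"
  by (simp add: swap_1_2_def)

lemma twisted_label_image:
  assumes "n \<ge> 3"
  shows "(\<lambda>s. row n (twisted_label n x s + d)) ` {..<n} = {..<n}"
proof -
  have n0: "n > 0" using assms by simp
  have "swap_1_2 ` {..<n} = {..<n}"
  proof (intro equalityI subsetI)
    fix v assume "v \<in> {..<n}"
    then have "v = swap_1_2 (swap_1_2 v)" "swap_1_2 v \<in> {..<n}"
      using swap_1_2_less[OF assms] by (simp_all add: swap_1_2_idem)
    then show "v \<in> swap_1_2 ` {..<n}" by (rule image_eqI)
  qed (use swap_1_2_less[OF assms] in auto)
  moreover have "(\<lambda>s. row n (int s + - int x)) ` {..<n} = {..<n}"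
    using row_image[OF n0, of "\<lambda>s. s" "- int x"] by simp
  moreover have "(\<lambda>s. swap_1_2 (row n (int s - int x))) ` {..<n} =
      swap_1_2 ` (\<lambda>s. row n (int s + - int x)) ` {..<n}"
    by (simp add: image_image)
  ultimately have "(\<lambda>s. swap_1_2 (row n (int s - int x))) ` {..<n} = {..<n}"
    by (simp only:)
  from row_image[OF n0 this, of "int x + d"] show ?thesis
    by (simp add: twisted_label_def add.assoc)
qed

section \<open>The edges for \<open>b = 1\<close>\<close>

context
  fixes m n :: nat
  assumes m: "m \<ge> 3" and n: "n = m + 2 * 1"
begin

text \<open>For \<open>b = 1\<close> nothing is rewired and all gaps look alike: the edges lead from
  each slot to the next, except that the one joining 1 and 2 leads from 2 to 1.\<close>

lemma gap_edge_1:
  assumes "x < m" "s < n" "s \<noteq> 1"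
  shows "gap_edge (layout m 1) m n x s ((s + 1) mod n)"
proof (cases "s \<le> 2")
  case True
  with assms have "s = 0 \<or> s = 2" by linarith
  moreover have "(s + 1) mod n = s + 1" using True n m by simp
  ultimately show ?thesis
    using gap_edge_zigzag[OF m n, of x s] assms by auto
next
  case False
  then show ?thesis using gap_edge_straight[OF m n, of x s] assms by simp
qed

lemma gap_edge_1':
  assumes "x < m"
  shows "gap_edge (layout m 1) m n x 2 1"
  using gap_edge_zigzag[OF m n, of x 1] assms by (simp add: numeral_2_eq_2)

end

context
  fixes m n :: nat
  assumes m: "m \<ge> 5" and n: "n = m + 2" and odd_m: "odd m"
begin

lemma m3: "m \<ge> 3" "n = m + 2 * 1"
  using m n by simp_all

text \<open>Along an edge from \<open>k\<close> to \<open>k + 1\<close> both labels come from the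
  same residue \<open>w = k - x\<close>, so their sum is \<open>2 * swap_1_2 w + 2 * x + 1\<close>.
  As \<open>n\<close> is odd, a suitable \<open>w\<close> yields any prescribed sum modulo
  \<open>n\<close>.\<close>

lemma cover_twisted:
  assumes x: "3 \<le> x" "x < m - 1" and i: "i < n" "i' < n"
  shows "\<exists>c < n. \<exists>s t. gap_edge (layout m 1) m n x s t \<and>
    row n (twisted_label n x s + parity_sign x * int c) = i \<and>
    row n (twisted_label n (x + 1) t + parity_sign (x + 1) * int c) = i'"
proof -
  have n0: "n > 0" "n \<ge> 3" "x < m" "odd n" using n m x odd_m by simp_all
  let ?z = "int i + int i' - 2 * int x - 1"
  obtain u where u: "u < n" "(2 * int u - ?z) mod int n = 0"
    using n0(4) by (rule halve)
  have "\<exists>s t. gap_edge (layout m 1) m n x s t \<and>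
    (twisted_label n x s + twisted_label n (x + 1) t - (2 * int u + 2 * int x + 1)) mod int n = 0"
  proof -
    define w where "w = swap_1_2 u"
    have w: "w < n" "swap_1_2 w = u" using u n0 by (simp_all add: w_def swap_1_2_less swap_1_2_idem)
    define k where "k = row n (int w + int x)"
    have k: "k < n" using n0 by (simp add: k_def)
    have rk: "row n (int k - int x) = w"
    proof -
      have "row n (int k - int x) = row n (int w + int x - int x)"
        unfolding k_def int_row[OF n0(1)] unfolding row_def by (simp only: mod_diff_left_eq)
      then show ?thesis using w by (simp add: row_of_nat)
    qed
    show ?thesis
    proof (cases "k = 1")
      case False
      have "row n (int ((k + 1) mod n) - int (x + 1)) = row n (int (k + 1) - int (x + 1))"
        unfolding of_nat_mod row_def by (simp only: mod_diff_left_eq)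
      then have "row n (int ((k + 1) mod n) - int (x + 1)) = w" using rk by simp
      then have "twisted_label n x k + twisted_label n (x + 1) ((k + 1) mod n) =
          2 * int u + 2 * int x + 1"
        unfolding twisted_label_def rk w by (simp add: w)
      then show ?thesis using gap_edge_1[OF m3 n0(3) k False] by (intro exI conjI) auto
    next
      \<comment> \<open>No edge leads on from slot 1. The edge from 2 to 1 has label sum
        \<open>2 * n + 3\<close>, just the missing value; the bounds on \<open>x\<close> keep the
        residues involved away from the wrap-around and from the interchanged labels.\<close>
      case True
      have "row n (1 - int x) = w" using rk True by simp
      moreover have "row n (1 - int x) = n + 1 - x"
        using x n m by (intro row_of_nat_diff) auto
      ultimately have "w = n + 1 - x" by simp
      moreover from this have "u = w" using w x n by (simp add: swap_1_2_def split: if_splits)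
      ultimately have ux: "int u = int n + 1 - int x" using x n by simp
      have *: "row n (2 - int x) = n + 2 - x" "row n (1 - int (x + 1)) = n - x"
        using x n m by (intro row_of_nat_diff; auto)+
      have "twisted_label n x 2 + twisted_label n (x + 1) 1 = 2 * int u + 2 * int x + 1"
      proof -
        have "n + 2 - x \<ge> 3" "n - x \<ge> 3" using x n by simp_all
        then have "swap_1_2 (n + 2 - x) = n + 2 - x" "swap_1_2 (n - x) = n - x"
          by (simp_all add: swap_1_2_def)
        then show ?thesis using * x n unfolding twisted_label_def ux by simp
      qed
      then show ?thesis using gap_edge_1'[OF m3 n0(3)] by (intro exI conjI) auto
    qed
  qed
  then obtain s t where st: "gap_edge (layout m 1) m n x s t"
    "(twisted_label n x s + twisted_label n (x + 1) t - (2 * int u + 2 * int x + 1)) mod int n = 0"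
    by (elim exE conjE)
  have "int n dvd twisted_label n x s + twisted_label n (x + 1) t - (2 * int u + 2 * int x + 1)"
    "int n dvd 2 * int u - ?z"
    using st(2) u(2) by (simp_all only: mod_eq_0_iff_dvd)
  from dvd_add[OF this] have "(twisted_label n x s + twisted_label n (x + 1) t - int i - int i') mod int n = 0"
    by (simp add: mod_eq_0_iff_dvd algebra_simps)
  then show ?thesis
    unfolding parity_sign_Suc
    by (intro cover_sum[where E = "gap_edge (layout m 1) m n x"])
      (use n0 parity_sign_square i st in simp_all)
qed

text \<open>Column 1 borders only on the still columns 0 and 2, so its labelling \<open>xi\<close>
  can be an arbitrary permutation. The gaps between the columns \<open>3, ..., m - 1\<close> are
  settled by \<open>cover_twisted\<close>.\<close>

lemma factorization_two_still_columns:
  assumes B0: "\<And>c. B0 c ` {..<n} = {..<n}" and B2: "\<And>c. B2 c ` {..<n} = {..<n}"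
    and xi: "xi ` {..<n} = {..<n}"
    and gap_left: "\<And>v i'. v < n \<Longrightarrow> i' < n \<Longrightarrow> \<exists>c < n. \<exists>s t. gap_edge (layout m 1) m n (m - 1) t s \<and>
      B0 (int c) s = v \<and> row n (twisted_label n (m - 1) t + 1 * int c) = i'"
    and gap_0: "\<And>v i'. v < n \<Longrightarrow> i' < n \<Longrightarrow> \<exists>c < n. \<exists>s t. gap_edge (layout m 1) m n 0 s t \<and>
      B0 (int c) s = v \<and> row n (int (xi t) + - 1 * int c) = i'"
    and gap_1: "\<And>v i'. v < n \<Longrightarrow> i' < n \<Longrightarrow> \<exists>c < n. \<exists>s t. gap_edge (layout m 1) m n 1 t s \<and>
      B2 (int c) s = v \<and> row n (int (xi t) + - 1 * int c) = i'"
    and gap_2: "\<And>v i'. v < n \<Longrightarrow> i' < n \<Longrightarrow> \<exists>c < n. \<exists>s t. gap_edge (layout m 1) m n 2 s t \<and>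
      B2 (int c) s = v \<and> row n (twisted_label n 3 t + - 1 * int c) = i'"
  shows "(\<exists>P. cycle_factorization n (cycle_blowup m n) P) \<and> (0, n) \<in> HWP (cycle_blowup m n) m n"
proof -
  have n3: "n \<ge> 3" "n > 0" using n m by simp_all
  let ?L = "\<lambda>x c s. if x = 0 then B0 (int c) s
    else if x = 1 then row n (int (xi s) + - 1 * int c)
    else if x = 2 then B2 (int c) s
    else row n (twisted_label n x s + parity_sign x * int c)"
  show ?thesis
  proof (rule factorization_from_arrays[OF m3(1) n3(1) layout_image[OF m3] layout_adjacent[OF m3]])
    show "?L x c ` {..<n} = {..<n}" if "x < m" "c < n" for x c
      using B0 B2 row_image[OF n3(2) xi, of "- int c"] twisted_label_image[OF n3(1)] by simp
    show "\<exists>c < n. \<exists>s t. gap_edge (layout m 1) m n x s t \<and> ?L x c s = i \<and> ?L ((x + 1) mod m) c t = i'"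
      if x: "x < m" "i < n" "i' < n" for x i i'
    proof -
      consider "x = 0" | "x = 1" | "x = 2" | "x = m - 1" "3 \<le> x" | "3 \<le> x" "x < m - 1"
        using x(1) m by linarith
      then show ?thesis
      proof cases
        case 1
        then show ?thesis using gap_0[OF x(2,3)] m by simp
      next
        case 2
        moreover have "(1 + 1) mod m = 2" using m by simp
        ultimately show ?thesis using gap_1[OF x(3,2)] by auto
      next
        case 3
        moreover have "(2 + 1) mod m = 3" "parity_sign 3 = - 1" using m by (simp_all add: parity_sign_def)
        ultimately show ?thesis using gap_2[OF x(2,3)] by auto
      next
        case 4
        moreover have "parity_sign (m - 1) = 1" "(m - 1 + 1) mod m = 0"
          using odd_m m by (simp_all add: parity_sign_def)
        moreover obtain c s t where "c < n" "gap_edge (layout m 1) m n (m - 1) t s" "B0 (int c) s = i'"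
          "row n (twisted_label n (m - 1) t + 1 * int c) = i"
          using gap_left[OF x(3,2)] by (elim exE conjE)
        ultimately have "c < n" "gap_edge (layout m 1) m n x t s" "?L x c t = i"
          "?L ((x + 1) mod m) c s = i'"
          using m by simp_all
        then show ?thesis by (intro exI conjI)
      next
        case 5
        moreover have "(x + 1) mod m = x + 1" using 5 by simp
        ultimately show ?thesis using cover_twisted[OF 5 x(2,3)] by simp
      qed
    qed
  qed
qed

text \<open>\<open>A\<close> is the edge relation of every gap. Slot 1 has no right and slot 2 no
  left neighbour, so both must be among the exchanged slots. The remaining assumptions are the
  conditions of \<open>cover_buffer\<close> on the two sides of column 0, for \<open>e\<close>, and
  of column 2, for \<open>e'\<close>.\<close>

lemma factorization_by_buffers:
  assumes q: "rainbow n q"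
    and e: "length e = 4" "distinct e" "set e \<subseteq> {..<n}" "{1, 2} \<subseteq> set e"
    and e': "length e' = 4" "distinct e'" "set e' \<subseteq> {..<n}" "{1, 2} \<subseteq> set e'"
    and xi: "xi ` {..<n} = {..<n}"
    and A: "A = (\<lambda>s t. s \<noteq> 1 \<and> s < n \<and> t = (s + 1) mod n \<or> s = 2 \<and> t = (1::nat))"
    and left3: "A ta (e ! 3)"
    and left: "\<And>d. d \<in> {0, 1, 2} \<Longrightarrow> \<exists>i \<in> {0, 1, 2}. \<exists>t. A t (e ! i) \<and>
      (- 1 * twisted_label n (m - 1) t + 2 * int i - (- 1 * twisted_label n (m - 1) ta) - 2 * int d) mod int n = 0"
    and right3: "A (e ! 3) tb"
    and right: "\<And>d. d \<in> {0, 1, 2} \<Longrightarrow> \<exists>i \<in> {0, 1, 2}. \<exists>t. A (e ! i) t \<and>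
      (- (- 1) * int (xi t) + 2 * int i - (- (- 1) * int (xi tb)) - 2 * int d) mod int n = 0"
    and left3': "A ta' (e' ! 3)"
    and left': "\<And>d. d \<in> {0, 1, 2} \<Longrightarrow> \<exists>i \<in> {0, 1, 2}. \<exists>t. A t (e' ! i) \<and>
      (- (- 1) * int (xi t) + 2 * int i - (- (- 1) * int (xi ta')) - 2 * int d) mod int n = 0"
    and right3': "A (e' ! 3) tb'"
    and right': "\<And>d. d \<in> {0, 1, 2} \<Longrightarrow> \<exists>i \<in> {0, 1, 2}. \<exists>t. A (e' ! i) t \<and>
      (- (- 1) * twisted_label n 3 t + 2 * int i - (- (- 1) * twisted_label n 3 tb') - 2 * int d) mod int n = 0"
  shows "(\<exists>P. cycle_factorization n (cycle_blowup m n) P) \<and> (0, n) \<in> HWP (cycle_blowup m n) m n"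
proof -
  have n1: "1 < n" using n by simp
  have edge: "gap_edge (layout m 1) m n x s t" if "A s t" "x < m" for x s t
    using that gap_edge_1[OF m3, of x s] gap_edge_1'[OF m3, of x] unfolding A by auto
  have AR: "\<exists>t. A s t" if "s < n" "s \<noteq> 1" for s using that unfolding A by blast
  have AL: "\<exists>t. A t s" if "s < n" "s \<noteq> 2" for s
  proof (cases "s = 0")
    case True
    then have "A (n - 1) s" using n m unfolding A by simp
    then show ?thesis by (rule exI)
  next
    case False
    then have "s - 1 \<noteq> 1" "s - 1 < n" "(s - 1 + 1) mod n = s" using that by auto
    then have "A (s - 1) s" unfolding A by simp
    then show ?thesis by (rule exI)
  qed
  have x: "m - 1 < m" "0 < m" "1 < m" "2 < m" using m by simp_all
  show ?thesis
  proof (rule factorization_two_still_columns[OF buffer_image[OF q e(1-3)] buffer_image[OF q e'(1-3)] xi])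
    fix v i' assume v: "v < n" "i' < n"
    have mono: "\<exists>c < n. \<exists>s t. E' s t \<and> P c s t" if "\<exists>c < n. \<exists>s t. E s t \<and> P c s t" "\<And>s t. E s t \<Longrightarrow> E' s t"
      for E E' :: "nat \<Rightarrow> nat \<Rightarrow> bool" and P :: "nat \<Rightarrow> nat \<Rightarrow> nat \<Rightarrow> bool"
      using that by meson
    have "\<exists>c < n. \<exists>s t. A t s \<and> buffer q e (int c) s = v \<and>
        row n (twisted_label n (m - 1) t + 1 * int c) = i'"
      by (rule cover_buffer[OF q e(1,2) _ AL left3 left v])
        (use e(4) in auto)
    then show "\<exists>c < n. \<exists>s t. gap_edge (layout m 1) m n (m - 1) t s \<and> buffer q e (int c) s = v \<and>
        row n (twisted_label n (m - 1) t + 1 * int c) = i'"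
      by (rule mono) (rule edge[OF _ x(1)])
    have "\<exists>c < n. \<exists>s t. A s t \<and> buffer q e (int c) s = v \<and>
        row n (int (xi t) + - 1 * int c) = i'"
      by (rule cover_buffer[OF q e(1,2) _ AR right3 right v])
        (use e(4) in auto)
    then show "\<exists>c < n. \<exists>s t. gap_edge (layout m 1) m n 0 s t \<and> buffer q e (int c) s = v \<and>
        row n (int (xi t) + - 1 * int c) = i'"
      by (rule mono) (rule edge[OF _ x(2)])
    have "\<exists>c < n. \<exists>s t. A t s \<and> buffer q e' (int c) s = v \<and>
        row n (int (xi t) + - 1 * int c) = i'"
      by (rule cover_buffer[OF q e'(1,2) _ AL left3' left' v])
        (use e'(4) in auto)
    then show "\<exists>c < n. \<exists>s t. gap_edge (layout m 1) m n 1 t s \<and> buffer q e' (int c) s = v \<and>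
        row n (int (xi t) + - 1 * int c) = i'"
      by (rule mono) (rule edge[OF _ x(3)])
    have "\<exists>c < n. \<exists>s t. A s t \<and> buffer q e' (int c) s = v \<and>
        row n (twisted_label n 3 t + - 1 * int c) = i'"
      by (rule cover_buffer[OF q e'(1,2) _ AR right3' right' v])
        (use e'(4) in auto)
    then show "\<exists>c < n. \<exists>s t. gap_edge (layout m 1) m n 2 s t \<and> buffer q e' (int c) s = v \<and>
        row n (twisted_label n 3 t + - 1 * int c) = i'"
      by (rule mono) (rule edge[OF _ x(4)])
  qed
qed

end

section \<open>Explicit exchanged slots and labellings for \<open>n = m + 2\<close>\<close>

lemma twisted_label_eq: "row n (int s - int x) = i \<Longrightarrow> twisted_label n x s = int (swap_1_2 i) + int x"
  by (simp add: twisted_label_def)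

lemma less_3_cases:
  assumes "d \<in> {0, 1, 2::nat}"
  obtains "d = 0" | "d = 1" | "d = 2"
  using assms by (elim insertE emptyE)

text \<open>The exchanged slots and the labellings below were found by a computer search.\<close>

lemma factorization_5_7:
  "(\<exists>P. cycle_factorization 7 (cycle_blowup 5 7) P) \<and> (0, 7) \<in> HWP (cycle_blowup 5 7) 5 7"
proof -
  obtain q where q: "rainbow 7 q" by (rule rainbow_exists[of 7]) simp_all
  let ?xi = "\<lambda>s. [3, 2, 5, 4, 0, 6, 1] ! s :: nat"
  have 7: "{..<7} = {0, 1, 2, 3, 4, 5, 6::nat}" by auto
  have A: "A s t" if "A = (\<lambda>s t. s \<noteq> 1 \<and> s < 7 \<and> t = (s + 1) mod 7 \<or> s = 2 \<and> t = (1::nat))"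
    "(s, t) \<in> {(0, 1), (2, 1), (2, 3), (3, 4), (4, 5), (5, 6), (6, 0)}" for A s t
    using that by auto
  define A where "A = (\<lambda>s t. s \<noteq> 1 \<and> s < 7 \<and> t = (s + 1) mod 7 \<or> s = 2 \<and> t = (1::nat))"
  note A = A[OF A_def]
  have L4: "twisted_label 7 4 0 = 7" "twisted_label 7 4 2 = 9" "twisted_label 7 4 5 = 6"
    and L3: "twisted_label 7 3 1 = 8" "twisted_label 7 3 3 = 3" "twisted_label 7 3 5 = 4"
    by (simp_all add: twisted_label_def swap_1_2_def row_def)
  show ?thesis
  \<comment> \<open>\<open>ta\<close> and \<open>tb\<close> are the left and right neighbours of
    slot 3, the last one in \<open>e\<close>; \<open>ta'\<close> and \<open>tb'\<close> are those of
    slot 0, the last one in \<open>e'\<close>.\<close>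
  proof (rule factorization_by_buffers[OF _ _ _ q _ _ _ _ _ _ _ _ _ A_def, where e = "[2, 1, 6, 3]"
        and e' = "[1, 2, 4, 0]" and xi = ?xi and ta = 2 and tb = 4 and ta' = 6 and tb' = 1])
    show "?xi ` {..<7} = {..<7}" unfolding 7 by auto
    fix d :: nat assume d: "d \<in> {0, 1, 2}"
    show "\<exists>i\<in>{0, 1, 2}. \<exists>t. A t ([2, 1, 6, 3] ! i) \<and> (- 1 * twisted_label 7 (5 - 1) t + 2 * int i -
        - 1 * twisted_label 7 (5 - 1) 2 - 2 * int d) mod int 7 = 0"
      using d
    proof (cases rule: less_3_cases)
      case 1 then show ?thesis by (intro bexI[of _ 2] exI[of _ 5] conjI A) (simp_all add: L4)
    next
      case 2 then show ?thesis by (intro bexI[of _ 1] exI[of _ 2] conjI A) (simp_all add: L4)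
    next
      case 3 then show ?thesis by (intro bexI[of _ 1] exI[of _ 0] conjI A) (simp_all add: L4)
    qed
    show "\<exists>i\<in>{0, 1, 2}. \<exists>t. A ([2, 1, 6, 3] ! i) t \<and> (- (- 1) * int (?xi t) + 2 * int i -
        - (- 1) * int (?xi 4) - 2 * int d) mod int 7 = 0"
      using d
    proof (cases rule: less_3_cases)
      case 1 then show ?thesis by (intro bexI[of _ 2] exI[of _ 0] conjI A) simp_all
    next
      case 2 then show ?thesis by (intro bexI[of _ 0] exI[of _ 1] conjI A) simp_all
    next
      case 3 then show ?thesis by (intro bexI[of _ 0] exI[of _ 3] conjI A) simp_all
    qed
    show "\<exists>i\<in>{0, 1, 2}. \<exists>t. A t ([1, 2, 4, 0] ! i) \<and> (- (- 1) * int (?xi t) + 2 * int i -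
        - (- 1) * int (?xi 6) - 2 * int d) mod int 7 = 0"
      using d
    proof (cases rule: less_3_cases)
      case 1 then show ?thesis by (intro bexI[of _ 2] exI[of _ 3] conjI A) simp_all
    next
      case 2 then show ?thesis by (intro bexI[of _ 0] exI[of _ 0] conjI A) simp_all
    next
      case 3 then show ?thesis by (intro bexI[of _ 0] exI[of _ 2] conjI A) simp_all
    qed
    show "\<exists>i\<in>{0, 1, 2}. \<exists>t. A ([1, 2, 4, 0] ! i) t \<and> (- (- 1) * twisted_label 7 3 t + 2 * int i -
        - (- 1) * twisted_label 7 3 1 - 2 * int d) mod int 7 = 0"
      using d
    proof (cases rule: less_3_cases)
      case 1 then show ?thesis by (intro bexI[of _ 2] exI[of _ 5] conjI A) (simp_all add: L3 L3[simplified])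
    next
      case 2 then show ?thesis by (intro bexI[of _ 1] exI[of _ 1] conjI A) (simp_all add: L3 L3[simplified])
    next
      case 3 then show ?thesis by (intro bexI[of _ 1] exI[of _ 3] conjI A) (simp_all add: L3 L3[simplified])
    qed
  qed (use A in simp_all)
qed

text \<open>The listed labels are \<open>0, ..., 4\<close> and \<open>n - 4, ..., n - 1\<close>; the
  shift by 4 sends the other slots to \<open>5, ..., n - 5\<close>. For \<open>n = 7\<close> the
  listed labels would collide.\<close>

definition xi_large :: "nat \<Rightarrow> nat \<Rightarrow> nat" where
  "xi_large n s = (if s < 9 then [n - 3, 2, n - 1, 4, 0, 1, n - 2, 3, n - 4] ! s else s - 4)"

lemma xi_large_image:
  assumes "n \<ge> 9"
  shows "xi_large n ` {..<n} = {..<n}"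
proof (intro equalityI subsetI)
  obtain k where k: "n = k + 9" using assms by (metis add.commute le_Suc_ex)
  let ?f = "xi_large n"
  have f: "?f 4 = 0" "?f 5 = 1" "?f 1 = 2" "?f 7 = 3" "?f 3 = 4" "?f 8 = k + 5" "?f 0 = k + 6"
    "?f 6 = k + 7" "?f 2 = k + 8"
    by (simp_all add: k xi_large_def)
  have im: "?f s \<in> ?f ` {..<n}" if "s < n" for s using that by simp
  have vals: "0 \<in> ?f ` {..<n}" "1 \<in> ?f ` {..<n}" "2 \<in> ?f ` {..<n}" "3 \<in> ?f ` {..<n}"
    "4 \<in> ?f ` {..<n}" "k + 5 \<in> ?f ` {..<n}" "k + 6 \<in> ?f ` {..<n}"
    "k + 7 \<in> ?f ` {..<n}" "k + 8 \<in> ?f ` {..<n}"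
    using im[of 4] im[of 5] im[of 1] im[of 7] im[of 3] im[of 8] im[of 0] im[of 6] im[of 2] assms
    unfolding f by simp_all
  fix v assume "v \<in> {..<n}"
  then have v: "v < k + 9" using k by simp
  show "v \<in> ?f ` {..<n}"
  proof (cases "v < 5")
    case True
    have 5: "{..<5} = {0, 1, 2, 3, 4::nat}" by auto
    have "v \<in> {..<5}" using True by simp
    then show ?thesis unfolding 5 using vals(1-5) by (elim insertE emptyE) (simp_all only:)
  next
    case ge: False
    show ?thesis
    proof (cases "v < k + 5")
      case True
      then have "?f (v + 4) = v" "v + 4 < n" using ge by (simp_all add: k xi_large_def)
      then show ?thesis using im[of "v + 4"] by simp
    next
      case False
      then obtain j where j: "v = k + 5 + j" using le_Suc_ex not_less by metis
      with v have "j < 4" by simp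
      then have "v = k + 5 \<or> v = k + 6 \<or> v = k + 7 \<or> v = k + 8" unfolding j by linarith
      then show ?thesis using vals(6-9) by (elim disjE) (simp_all only:)
    qed
  qed
next
  fix v assume "v \<in> xi_large n ` {..<n}"
  then obtain s where s: "s < n" "v = xi_large n s" by auto
  show "v \<in> {..<n}"
  proof (cases "s < 9")
    case True
    have 9: "{..<9} = {0, 1, 2, 3, 4, 5, 6, 7, 8::nat}" by auto
    have "s \<in> {..<9}" using True by simp
    then show ?thesis unfolding 9 s(2) xi_large_def using assms by (elim insertE emptyE) simp_all
  qed (use s in \<open>simp add: xi_large_def\<close>)
qed

text \<open>One choice of slots serves all \<open>m \<ge> 7\<close>, because every label entering
  the congruences is a small constant or differs from \<open>n\<close> by one, at least modulo
  \<open>n\<close>. Slot 3, the last in both lists, has the neighbours 2 and 4.\<close>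

lemma factorization_plus_2:
  assumes m: "m \<ge> 7" and n: "n = m + 2" and odd_m: "odd m"
  shows "(\<exists>P. cycle_factorization n (cycle_blowup m n) P) \<and> (0, n) \<in> HWP (cycle_blowup m n) m n"
proof -
  have n9: "n \<ge> 9" "odd n" "n \<ge> 7" "m \<ge> 5" using m n odd_m by simp_all
  obtain q where q: "rainbow n q" by (rule rainbow_exists[OF n9(2,3)])
  define A where "A = (\<lambda>s t. s \<noteq> 1 \<and> s < n \<and> t = (s + 1) mod n \<or> s = 2 \<and> t = (1::nat))"
  have A: "A 0 1" "A 2 3" "A 3 4" "A 6 7" "A 7 8" using n9(1) by (simp_all add: A_def)
  have A': "A 2 1" "A 8 (9 mod n)" using n9 by (simp_all add: A_def)
  have xi: "int (xi_large n 0) = int n - 3" "int (xi_large n 1) = 2" "int (xi_large n 2) = int n - 1"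
    "int (xi_large n 3) = 4" "int (xi_large n 4) = 0" "int (xi_large n 7) = 3"
    "int (xi_large n 8) = int n - 4"
    using n9 by (simp_all add: xi_large_def)
  have m1: "int (m - 1) = int n - 3" using n m by simp
  have L: "twisted_label n (m - 1) 2 = int n + 2" "twisted_label n (m - 1) 0 = int n"
    "(twisted_label n (m - 1) 6 - (int n + 6)) mod int n = 0"
  proof -
    have "row n (int 2 - int (m - 1)) = 5" "row n (int 0 - int (m - 1)) = 3"
      unfolding m1 using n9 by (intro row_of_nat_diff; simp)+
    from this[THEN twisted_label_eq]
    show "twisted_label n (m - 1) 2 = int n + 2" "twisted_label n (m - 1) 0 = int n"
      unfolding m1 by (simp_all add: swap_1_2_def)
    show "(twisted_label n (m - 1) 6 - (int n + 6)) mod int n = 0"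
    \<comment> \<open>For \<open>n = 9\<close> the residue is 0 instead of 9, so the label agrees
      with \<open>n + 6\<close> only modulo \<open>n\<close>.\<close>
    proof (cases "n = 9")
      case True
      then have "row n (int 6 - int (m - 1)) = 0" unfolding m1 by (simp add: row_def)
      from twisted_label_eq[OF this] show ?thesis
        unfolding m1 using True by (simp add: swap_1_2_def)
    next
      case False
      then have "row n (int 6 - int (m - 1)) = 9"
        unfolding m1 using n9 by (intro row_of_nat_diff) simp_all
      from twisted_label_eq[OF this] show ?thesis
        unfolding m1 by (simp add: swap_1_2_def)
    qed
  qed
  have L': "twisted_label n 3 4 = 5" "twisted_label n 3 1 = int n + 1" "twisted_label n 3 3 = 3"
    "twisted_label n 3 (9 mod n) = 9"
  proof -
    \<comment> \<open>The interchange takes effect at slot 4: its residue 1 becomes 2, and the label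
      5 instead of 4.\<close>
    have "row n (int 4 - int 3) = 1" "row n (int 3 - int 3) = 0"
      using n9 by (intro row_eqI; simp)+
    from this[THEN twisted_label_eq] show "twisted_label n 3 4 = 5" "twisted_label n 3 3 = 3"
      by (simp_all add: swap_1_2_def)
    have "row n (int 1 - int 3) = n - 2"
      using n9 by (intro row_of_nat_diff) simp_all
    note r = twisted_label_eq[OF this]
    have "n - 2 \<ge> 3" using n9(1) by simp
    then have "swap_1_2 (n - 2) = n - 2" by (simp add: swap_1_2_def)
    then show "twisted_label n 3 1 = int n + 1" unfolding r using n9(1) by simp
    have "row n (int (9 mod n) - int 3) = 6"
    proof (cases "n = 9")
      case True
      then show ?thesis by (simp add: row_def)
    next
      case False
      then show ?thesis using n9 by (intro row_eqI) simp_all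
    qed
    from twisted_label_eq[OF this] show "twisted_label n 3 (9 mod n) = 9"
      by (simp add: swap_1_2_def)
  qed
  show ?thesis
  proof (rule factorization_by_buffers[OF n9(4) n odd_m q _ _ _ _ _ _ _ _ xi_large_image[OF n9(1)] A_def,
        where e = "[2, 1, 7, 3]" and e' = "[8, 1, 2, 3]" and ta = 2 and tb = 4 and ta' = 2 and tb' = 4])
    fix d :: nat assume d: "d \<in> {0, 1, 2}"
    show "\<exists>i\<in>{0, 1, 2}. \<exists>t. A t ([2, 1, 7, 3] ! i) \<and> (- 1 * twisted_label n (m - 1) t + 2 * int i -
        - 1 * twisted_label n (m - 1) 2 - 2 * int d) mod int n = 0"
      using d
    proof (cases rule: less_3_cases)
      case 1
      have "A 6 ([2, 1, 7, 3] ! 2)" using A(4) by simp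
      moreover have "(- 1 * twisted_label n (m - 1) 6 + 2 * int 2 -
        - 1 * twisted_label n (m - 1) 2 - 2 * int d) mod int n = 0"
      proof -
        have "- 1 * twisted_label n (m - 1) 6 + 2 * int 2 - - 1 * twisted_label n (m - 1) 2 - 2 * int d =
            int n + 6 - twisted_label n (m - 1) 6"
          unfolding 1 L(1) by simp
        then show ?thesis using L(3) by (simp only: mod_eq_0_iff_dvd dvd_diff_commute)
      qed
      ultimately show ?thesis by (intro bexI[of _ 2] exI[of _ 6] conjI) simp_all
    next
      case 2 then show ?thesis using A' by (intro bexI[of _ 1] exI[of _ 2] conjI) (simp_all add: L L[simplified])
    next
      case 3 then show ?thesis using A(1) by (intro bexI[of _ 1] exI[of _ 0] conjI) (simp_all add: L L[simplified])
    qed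
    show "\<exists>i\<in>{0, 1, 2}. \<exists>t. A ([2, 1, 7, 3] ! i) t \<and> (- (- 1) * int (xi_large n t) + 2 * int i -
        - (- 1) * int (xi_large n 4) - 2 * int d) mod int n = 0"
      using d
    proof (cases rule: less_3_cases)
      case 1
      have "A ([2, 1, 7, 3] ! 2) 8" using A(5) by simp
      moreover have "(- (- 1) * int (xi_large n 8) + 2 * int 2 - - (- 1) * int (xi_large n 4) - 2 * int d) mod int n = 0"
        unfolding 1 xi by simp
      ultimately show ?thesis by (intro bexI[of _ 2] exI[of _ 8] conjI) (assumption | simp)+
    next
      case 2
      have "A ([2, 1, 7, 3] ! 0) 1" using A' by simp
      moreover have "(- (- 1) * int (xi_large n 1) + 2 * int 0 - - (- 1) * int (xi_large n 4) - 2 * int d) mod int n = 0"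
        unfolding 2 xi by simp
      ultimately show ?thesis by (intro bexI[of _ 0] exI[of _ 1] conjI) (assumption | simp)+
    next
      case 3
      have "A ([2, 1, 7, 3] ! 0) 3" using A(2) by simp
      moreover have "(- (- 1) * int (xi_large n 3) + 2 * int 0 - - (- 1) * int (xi_large n 4) - 2 * int d) mod int n = 0"
        unfolding 3 xi by simp
      ultimately show ?thesis by (intro bexI[of _ 0] exI[of _ 3] conjI) (assumption | simp)+
    qed
    show "\<exists>i\<in>{0, 1, 2}. \<exists>t. A t ([8, 1, 2, 3] ! i) \<and> (- (- 1) * int (xi_large n t) + 2 * int i -
        - (- 1) * int (xi_large n 2) - 2 * int d) mod int n = 0"
      using d
    proof (cases rule: less_3_cases)
      case 1
      have "A 0 ([8, 1, 2, 3] ! 1)" using A(1) by simp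
      moreover have "(- (- 1) * int (xi_large n 0) + 2 * int 1 - - (- 1) * int (xi_large n 2) - 2 * int d) mod int n = 0"
        unfolding 1 xi by simp
      ultimately show ?thesis by (intro bexI[of _ 1] exI[of _ 0] conjI) (assumption | simp)+
    next
      case 2
      have "A 2 ([8, 1, 2, 3] ! 1)" using A' by simp
      moreover have "(- (- 1) * int (xi_large n 2) + 2 * int 1 - - (- 1) * int (xi_large n 2) - 2 * int d) mod int n = 0"
        unfolding 2 xi by simp
      ultimately show ?thesis by (intro bexI[of _ 1] exI[of _ 2] conjI) (assumption | simp)+
    next
      case 3
      have "A 7 ([8, 1, 2, 3] ! 0)" using A(5) by simp
      moreover have "(- (- 1) * int (xi_large n 7) + 2 * int 0 - - (- 1) * int (xi_large n 2) - 2 * int d) mod int n = 0"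
        unfolding 3 xi by simp
      ultimately show ?thesis by (intro bexI[of _ 0] exI[of _ 7] conjI) (assumption | simp)+
    qed
    show "\<exists>i\<in>{0, 1, 2}. \<exists>t. A ([8, 1, 2, 3] ! i) t \<and> (- (- 1) * twisted_label n 3 t + 2 * int i -
        - (- 1) * twisted_label n 3 4 - 2 * int d) mod int n = 0"
      using d
    proof (cases rule: less_3_cases)
      case 1 then show ?thesis using A' by (intro bexI[of _ 2] exI[of _ 1] conjI) (simp_all add: L'[simplified])
    next
      case 2 then show ?thesis using A(2) by (intro bexI[of _ 2] exI[of _ 3] conjI) (simp_all add: L')
    next
      case 3 then show ?thesis using A' by (intro bexI[of _ 0] exI[of _ "9 mod n"] conjI) (simp_all add: L')
    qed
  qed (use A(2) A(3) n9 in simp_all)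
qed

text \<open>With only three columns there is no room for a second still column. This solution was found by a
  SAT solver: rotating the columns permutes the factors \<open>0, 1, 2\<close> and fixes \<open>3\<close> and \<open>4\<close>.\<close>

lemma factorization_3_5:
  "(\<exists>P. cycle_factorization 5 (cycle_blowup 3 5) P) \<and> (0, 5) \<in> HWP (cycle_blowup 3 5) 3 5"
proof -
  define R where "R = ([[0, 3, 2, 4, 1], [3, 2, 4, 1, 0], [3, 1, 4, 2, 0], [2, 4, 3, 1, 0], [0, 4, 1, 2, 3]] :: nat list list)"
  \<comment> \<open>For the factors 0, 1, 2, passing to the next column advances the index into
    \<open>R\<close> by 2 modulo 3; the factors 3 and 4 look the same in every column.\<close>
  define L where "L x c s = R ! (if c < 3 then (c + 2 * x) mod 3 else c) ! s" for x c s :: nat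
  have p: "(3::nat) \<ge> 3" "(5::nat) = 3 + 2 * 1" by simp_all
  have 5: "{..<5} = {0, 1, 2, 3, 4::nat}" and 3: "{..<3} = {0, 1, 2::nat}" by auto
  have edges: "gap_edge (layout 3 1) 3 5 x s t"
    if "x < 3" "(s, t) \<in> set [(0, 1), (2, 1), (2, 3), (3, 4), (4, 0)]" for x s t
  proof -
    from that(2) have "s \<noteq> 1 \<and> s < 5 \<and> t = (s + 1) mod 5 \<or> s = 2 \<and> t = 1" by auto
    then show ?thesis
      using gap_edge_1[OF p that(1), of s] gap_edge_1'[OF p that(1)] by (elim disjE conjE) simp_all
  qed
  show ?thesis
  proof (rule factorization_from_arrays[OF p(1) _ layout_image[OF p] layout_adjacent[OF p]])
    show "L x c ` {..<5} = {..<5}" if "x < 3" "c < 5" for x c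
    proof -
      have "(c + 2 * x) mod 3 < 3" by (rule mod_less_divisor) simp
      then have r: "(if c < 3 then (c + 2 * x) mod 3 else c) \<in> {..<5}"
        using that(2) by (simp del: mod_less_divisor)
      have "\<forall>r \<in> {..<5}. (!) (R ! r) ` {..<5} = {..<5}"
        unfolding 5 R_def by auto
      from bspec[OF this r] show ?thesis unfolding L_def .
    qed
    show "\<exists>c<5. \<exists>s t. gap_edge (layout 3 1) 3 5 x s t \<and> L x c s = i \<and> L ((x + 1) mod 3) c t = i'"
      if x: "x < 3" "i < 5" "i' < 5" for x i i'
    proof -
      \<comment> \<open>A finite check over all 75 edges of the graph, with lists in place of sets
        so that simplification evaluates it.\<close>
      have "list_all (\<lambda>x. list_all (\<lambda>i. list_all (\<lambda>i'. list_ex (\<lambda>c. list_ex (\<lambda>(s, t). L x c s = i \<and>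
          L ((x + 1) mod 3) c t = i') [(0, 1), (2, 1), (2, 3), (3, 4), (4, 0)])
        [0, 1, 2, 3, 4]) [0, 1, 2, 3, 4]) [0, 1, 2, 3, 4]) [0, 1, 2]"
        by (simp add: L_def R_def)
      then have "\<forall>x\<in>{..<3}. \<forall>i\<in>{..<5}. \<forall>i'\<in>{..<5}. \<exists>c\<in>{..<5}.
        \<exists>(s, t)\<in>set [(0, 1), (2, 1), (2, 3), (3, 4), (4, 0)]. L x c s = i \<and> L ((x + 1) mod 3) c t = i'"
        unfolding 3 5 list_all_iff list_ex_iff by (simp only: list.set)
      from bspec[OF bspec[OF bspec[OF this]], of x i i'] x have "\<exists>c\<in>{..<5}. \<exists>(s, t)\<in>set [(0, 1), (2, 1), (2, 3), (3, 4), (4, 0)].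
          L x c s = i \<and> L ((x + 1) mod 3) c t = i'"
        by (simp only: lessThan_iff)
      then obtain c p where c: "c \<in> {..<5}" and p: "p \<in> set [(0, 1), (2, 1), (2, 3), (3, 4), (4, 0)]"
        "case p of (s, t) \<Rightarrow> L x c s = i \<and> L ((x + 1) mod 3) c t = i'"
        by (elim bexE)
      obtain s t where st: "p = (s, t)" by (cases p)
      have "c < 5" "gap_edge (layout 3 1) 3 5 x s t" "L x c s = i" "L ((x + 1) mod 3) c t = i'"
        using c p(2) edges[OF x(1) p(1)[unfolded st]] unfolding st by simp_all
      then show ?thesis by (intro exI conjI)
    qed
  qed simp
qed

theorem theorem3p5:
  fixes m n :: nat
  assumes "odd m" and "odd n" and "3 \<le> m" and "m \<le> n"
  shows "(\<exists>P. cycle_factorization n (cycle_blowup m n) P) \<and> (0, n) \<in> HWP (cycle_blowup m n) m n"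
proof -
  have "even (n - m)" using assms by simp
  then obtain b where "n - m = 2 * b" by (elim evenE)
  then have n: "n = m + 2 * b" using assms(4) by simp
  \<comment> \<open>For \<open>b = 1\<close> there is no rewired block, hence none that could lend
    the two further slots to be exchanged.\<close>
  consider "even b" | "b = 1" | "odd b" "b \<ge> 3" by (cases "even b"; cases "b = 1") (auto elim: oddE)
  then show ?thesis
  proof cases
    case 1
    then show ?thesis by (rule factorization_even[OF assms(3) n assms(1)])
  next
    case 2
    with n have n2: "n = m + 2" by simp
    have "m \<noteq> 4" "m \<noteq> 6" using assms(1) by auto
    then have "m = 3 \<or> m = 5 \<or> m \<ge> 7" using assms(3) by linarith
    then show ?thesis
    proof (elim disjE)
      assume "m = 3"
      then show ?thesis using factorization_3_5 n2 by simp
    next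
      assume "m = 5"
      then show ?thesis using factorization_5_7 n2 by simp
    next
      assume "m \<ge> 7"
      then show ?thesis by (rule factorization_plus_2[OF _ n2 assms(1)])
    qed
  next
    case 3
    then have "even (b - 3)" by simp
    then obtain d where "b - 3 = 2 * d" by (elim evenE)
    then have "b = 2 * d + 3" using 3(2) by simp
    then show ?thesis by (rule factorization_odd[OF assms(3) n assms(1)])
  qed
qed

end
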